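(* Let $(X,T)$ be a topological dynamical system with finite topological entropy, $h(T,X)<+\infty$. Then $(X,T)$ is hereditarily lowerable; that is, for every nonempty compact set $K\subset X$ and every real $h$ with $0\leq h\leq h(T,K)$ there is a nonempty compact set $K_h\subset K$ such that $h(T,K_h)=h$.
   Context: A topological dynamical system $(X,T)$ is a compact metric space $X$ together with a homeomorphism $T\colon X\to X$. Logarithms are natural. For a finite open cover $\mathcal U$ of $X$, put $\mathcal U_0^{n-1}=\bigvee_{i=0}^{n-1}T^{-i}\mathcal U$ (the cover by all intersections $\bigcap_{i=0}^{n-1}T^{-i}U_i$ with $U_i\in\mathcal U$). For a compact set $K\subset X$ let $N(\mathcal U_0^{n-1},K)$ be the least number of members of $\mathcal U_0^{n-1}$ needed to cover $K$, and define $$h(T,\mathcal U,K)=\limsup_{n\to\infty}\frac1n\log N(\mathcal U_0^{n-1},K),\qquad h(T,K)=\sup_{\mathcal U}h(T,\mathcal U,K),$$ the supremum being over finite open covers of $X$. This is the topological entropy of $K$ (note $K$ need not be $T$-invariant). The topological entropy of the system is $h_{\mathrm{top}}(T,X)=h(T,X)$. *)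

theory Defs
  imports "HOL-Analysis.Analysis"
begin

text \<open>The space is a compact subset \<open>X\<close> of a metric space type; all topological
  notions are relative to \<open>X\<close>, and \<open>T\<close> matters only on \<open>X\<close>.\<close>

definition tds :: "'a::metric_space set \<Rightarrow> ('a \<Rightarrow> 'a) \<Rightarrow> bool" where
  "tds X T \<longleftrightarrow> compact X \<and> (\<exists>S. homeomorphism X X T S)"

definition finite_open_cover :: "'a::metric_space set \<Rightarrow> 'a set set \<Rightarrow> bool" where
  "finite_open_cover X \<U> \<longleftrightarrow>
     finite \<U> \<and> (\<forall>U\<in>\<U>. openin (top_of_set X) U) \<and> \<Union>\<U> = X"

text \<open>\<open>cover_join X T \<U> n\<close> is \<open>\<U>\<^sub>0\<^bsup>n-1\<^esup>\<close>.\<close>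

definition cover_join ::
    "'a set \<Rightarrow> ('a \<Rightarrow> 'a) \<Rightarrow> 'a set set \<Rightarrow> nat \<Rightarrow> 'a set set" where
  "cover_join X T \<U> n =
     {X \<inter> (\<Inter>i<n. (T ^^ i) -` V i) | V. \<forall>i<n. V i \<in> \<U>}"

definition cover_number :: "'a set set \<Rightarrow> 'a set \<Rightarrow> nat" where
  "cover_number \<V> K = (LEAST m. \<exists>\<F>\<subseteq>\<V>. finite \<F> \<and> card \<F> = m \<and> K \<subseteq> \<Union>\<F>)"

text \<open>The term for \<open>n = 0\<close> is irrelevant to the limit superior. For \<open>K = {}\<close> the
  covering number is \<open>0\<close> and the convention \<open>ln 0 = 0\<close> gives entropy \<open>0\<close>;
  for nonempty \<open>K\<close> covering numbers are at least \<open>1\<close>.\<close>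

definition cover_entropy ::
    "'a set \<Rightarrow> ('a \<Rightarrow> 'a) \<Rightarrow> 'a set set \<Rightarrow> 'a set \<Rightarrow> ereal" where
  "cover_entropy X T \<U> K =
     limsup (\<lambda>n. ereal (1 / real n * ln (real (cover_number (cover_join X T \<U> n) K))))"

definition entropy :: "'a::metric_space set \<Rightarrow> ('a \<Rightarrow> 'a) \<Rightarrow> 'a set \<Rightarrow> ereal" where
  "entropy X T K = (SUP \<U>\<in>{\<U>. finite_open_cover X \<U>}. cover_entropy X T \<U> K)"

definition hereditarily_lowerable :: "'a::metric_space set \<Rightarrow> ('a \<Rightarrow> 'a) \<Rightarrow> bool" where
  "hereditarily_lowerable X T \<longleftrightarrow>
     (\<forall>K. K \<subseteq> X \<and> K \<noteq> {} \<and> compact K \<longrightarrow>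
       (\<forall>h::real. 0 \<le> h \<and> ereal h \<le> entropy X T K \<longrightarrow>
         (\<exists>K\<^sub>h. K\<^sub>h \<subseteq> K \<and> K\<^sub>h \<noteq> {} \<and> compact K\<^sub>h \<and> entropy X T K\<^sub>h = ereal h)))"

end

theory Submission
  imports Defs "HOL-Library.Discrete_Functions"
begin

text \<open>Write \<open>H\<close> for the entropy of \<open>K\<close>, a real number because the system has finite entropy, and let \<open>0 < h < H\<close>. Entropy is
measured by the growth in \<open>n\<close> of sets that are separated by the orbits of length \<open>n\<close> at a scale \<open>e\<close> (\<open>growth_le\<close>; lemmas
\<open>entropy_le_of_growth_le\<close> and \<open>growth_le_of_entropy_le\<close>).

(For \<open>h = H\<close> take \<open>K\<close> itself, for \<open>h = 0\<close> a point.)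

It is easy to find subsets of \<open>K\<close> with entropy at least \<open>h\<close>: for a sequence of times \<open>n\<close>, take any \<open>exp (h * n)\<close> out of about
\<open>exp (H * n)\<close> points of \<open>K\<close> that are separated at a suitable scale. The difficulty is that the entropy may be
larger, because the chosen points may already be separated long before time \<open>n\<close>, at that scale or at a finer one. Choosing them
at random does not help.

The remedy is to choose them along a tree (\<open>thin_tree\<close>). For a finer scale and finitely many times up to \<open>n\<close>,
successive projections to spanning sets arrange the \<open>exp (H * n)\<close> points as the leaves of a tree, whose level for time \<open>m\<close>
has at most about \<open>exp (H * m)\<close> nodes, since this bound holds for all of \<open>K\<close> (\<open>projection_tree\<close>). At a cost that
is subexponential in \<open>n\<close> the tree can be made homogeneous, with about the same number \<open>D\<close> of children at all nodes of a
level. Now keep \<open>D powr (h / H)\<close> of the children everywhere. This raises all level sizes to the power \<open>h / H\<close>, so about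
\<open>exp (h * n)\<close> leaves remain, and only about \<open>exp (h * m)\<close> nodes at the level for time \<open>m\<close>
(\<open>thinned_separated_sets\<close>).

It remains to put such finite sets together. A sequence of sets shrinking to a point, with uniform growth bounds, has a subsequence
whose union with that point is compact and has no more entropy than the bounds say (\<open>glue_growth\<close>). Gluing the thinned sets
gives subsets of \<open>K\<close> with entropy in \<open>[h - eta, h]\<close> for every \<open>eta > 0\<close>
(\<open>approximate_lowering\<close>), and gluing small pieces of those, with \<open>eta\<close> tending to zero, gives entropy exactly \<open>h\<close>
(\<open>exact_lowering\<close>).\<close>

section \<open>Thinning a finite tree\<close>

lemma pigeonhole_popular:
  assumes "finite F" "f ` F \<subseteq> C" "finite C" "C \<noteq> {}"
  obtains c where "c \<in> C" "card F \<le> card {x\<in>F. f x = c} * card C"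
proof -
  have "\<exists>c\<in>C. card F \<le> card {x\<in>F. f x = c} * card C"
  proof (rule ccontr)
    assume "\<not> ?thesis"
    then have *: "\<And>c. c \<in> C \<Longrightarrow> card {x\<in>F. f x = c} * card C < card F" by force
    have "F = (\<Union>c\<in>C. {x\<in>F. f x = c})" using assms by auto
    then have "card F = card (\<Union>c\<in>C. {x\<in>F. f x = c})" by simp
    also have "\<dots> \<le> (\<Sum>c\<in>C. card {x\<in>F. f x = c})" using assms by (intro card_UN_le)
    finally have "card F * card C \<le> (\<Sum>c\<in>C. card {x\<in>F. f x = c} * card C)"
      by (metis mult_le_mono1 sum_distrib_right)
    also have "\<dots> < (\<Sum>c\<in>C. card F)" using assms * by (intro sum_strict_mono) auto
    finally show False by simp
  qed
  then show ?thesis using that by blast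
qed

text \<open>A finite set of leaves with a tree over it is encoded by the maps \<open>q j\<close> that send a leaf to its
  ancestor at height \<open>j\<close>; height \<open>0\<close> is that of the leaves. A subset of the leaves spans the subtree of their
  ancestors, so \<open>children q F j x\<close> counts the children, in the subtree spanned by \<open>F\<close>, of the
  ancestor of \<open>x\<close> at height \<open>j + 1\<close>.\<close>

definition children :: "(nat \<Rightarrow> 'a \<Rightarrow> 'b) \<Rightarrow> 'a set \<Rightarrow> nat \<Rightarrow> 'a \<Rightarrow> nat" where
  "children q F j x = card (q j ` {y\<in>F. q (Suc j) y = q (Suc j) x})"

locale leaf_tree =
  fixes q :: "nat \<Rightarrow> 'a \<Rightarrow> 'b"
  assumes coarser: "q j x = q j y \<Longrightarrow> q (Suc j) x = q (Suc j) y"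
begin

lemma coarser_le: "q j x = q j y \<Longrightarrow> j \<le> k \<Longrightarrow> q k x = q k y"
  by (induction k) (auto simp: le_Suc_eq intro: coarser)

text \<open>Cutting off whole branches at height \<open>k\<close> does not change the branching strictly below the cut. This is
  why the levels can be treated one after the other, from the leaves upwards.\<close>

lemma children_saturated:
  assumes "E \<subseteq> F" "x \<in> E" "j < k"
    and "\<And>y z. y \<in> E \<Longrightarrow> z \<in> F \<Longrightarrow> q k y = q k z \<Longrightarrow> z \<in> E"
  shows "children q E j x = children q F j x"
proof -
  have "{y\<in>E. q (Suc j) y = q (Suc j) x} = {y\<in>F. q (Suc j) y = q (Suc j) x}"
  proof
    show "{y\<in>F. q (Suc j) y = q (Suc j) x} \<subseteq> {y\<in>E. q (Suc j) y = q (Suc j) x}"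
    proof
      fix y assume "y \<in> {y\<in>F. q (Suc j) y = q (Suc j) x}"
      then have y: "y \<in> F" "q (Suc j) x = q (Suc j) y" by auto
      then have "q k x = q k y" using coarser_le[of "Suc j" x y k] \<open>j < k\<close> by simp
      then show "y \<in> {y\<in>E. q (Suc j) y = q (Suc j) x}" using assms y by auto
    qed
  qed (use assms in auto)
  then show ?thesis by (simp add: children_def)
qed

lemma card_level_step:
  assumes "finite F"
  shows "card (q j ` F) = (\<Sum>v\<in>q (Suc j) ` F. card (q j ` {y\<in>F. q (Suc j) y = v}))"
proof -
  have "q j ` F = (\<Union>v\<in>q (Suc j) ` F. q j ` {y\<in>F. q (Suc j) y = v})" by auto
  also have "card \<dots> = (\<Sum>v\<in>q (Suc j) ` F. card (q j ` {y\<in>F. q (Suc j) y = v}))"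
  proof (rule card_UN_disjoint)
    show "\<forall>v\<in>q (Suc j) ` F. \<forall>w\<in>q (Suc j) ` F. v \<noteq> w \<longrightarrow>
      q j ` {y \<in> F. q (Suc j) y = v} \<inter> q j ` {y \<in> F. q (Suc j) y = w} = {}"
      by (auto dest: coarser)
  qed (use assms in auto)
  finally show ?thesis .
qed

lemma card_level_ge:
  assumes "finite F" "\<And>j x. j < J \<Longrightarrow> x \<in> F \<Longrightarrow> d j \<le> children q F j x" "l \<le> J"
  shows "card (q J ` F) * (\<Prod>j=l..<J. d j) \<le> card (q l ` F)"
  using \<open>l \<le> J\<close>
proof (induction l rule: inc_induct)
  case (step l)
  have "card (q J ` F) * (\<Prod>j=l..<J. d j) = d l * (card (q J ` F) * (\<Prod>j=Suc l..<J. d j))"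
    using step by (simp add: prod.atLeast_Suc_lessThan)
  also have "\<dots> \<le> d l * card (q (Suc l) ` F)" using step by simp
  also have "\<dots> = (\<Sum>v\<in>q (Suc l) ` F. d l)" by simp
  also have "\<dots> \<le> (\<Sum>v\<in>q (Suc l) ` F. card (q l ` {y\<in>F. q (Suc l) y = v}))"
    using assms(2)[of l] step by (intro sum_mono) (auto simp: children_def)
  also have "\<dots> = card (q l ` F)" using card_level_step assms(1) by simp
  finally show ?case .
qed simp

lemma card_level_le:
  assumes "finite F" "\<And>j x. j < J \<Longrightarrow> x \<in> F \<Longrightarrow> children q F j x \<le> d j" "l \<le> J"
  shows "card (q l ` F) \<le> card (q J ` F) * (\<Prod>j=l..<J. d j)"
  using \<open>l \<le> J\<close>
proof (induction l rule: inc_induct)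
  case (step l)
  have "card (q l ` F) = (\<Sum>v\<in>q (Suc l) ` F. card (q l ` {y\<in>F. q (Suc l) y = v}))"
    using card_level_step assms(1) by simp
  also have "\<dots> \<le> (\<Sum>v\<in>q (Suc l) ` F. d l)"
    using assms(2)[of l] step by (intro sum_mono) (auto simp: children_def)
  also have "\<dots> = d l * card (q (Suc l) ` F)" by simp
  also have "\<dots> \<le> d l * (card (q J ` F) * (\<Prod>j=Suc l..<J. d j))" using step by simp
  also have "\<dots> = card (q J ` F) * (\<Prod>j=l..<J. d j)"
    using step by (simp add: prod.atLeast_Suc_lessThan)
  finally show ?case .
qed simp

text \<open>Level by level from the leaves upwards, sort the nodes into the \<open>L\<close> dyadic classes of their
  numbers of children and keep one that carries at least its share of the leaves. Each level costs a factor \<open>L\<close>, which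
  is only logarithmic in the number of leaves; afterwards all nodes of a level have the same number of children
  up to a factor \<open>2\<close>.\<close>

lemma homogeneous_subset:
  assumes "finite F" "F \<noteq> {}" "card F < 2 ^ L"
  shows "\<exists>F'\<subseteq>F. \<exists>D. F' \<noteq> {} \<and> card F \<le> card F' * L ^ J \<and>
    (\<forall>j<J. 1 \<le> D j \<and> (\<forall>x\<in>F'. D j \<le> children q F' j x \<and> children q F' j x \<le> 2 * D j))"
proof (induction J)
  case 0
  then show ?case using assms by auto
next
  case (Suc J)
  then obtain F' D where F': "F' \<subseteq> F" "F' \<noteq> {}" "card F \<le> card F' * L ^ J"
    and D: "\<And>j. j < J \<Longrightarrow> 1 \<le> D j"
      "\<And>j x. j < J \<Longrightarrow> x \<in> F' \<Longrightarrow> D j \<le> children q F' j x \<and> children q F' j x \<le> 2 * D j"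
    by blast
  have fin: "finite F'" using F' assms finite_subset by blast
  define k where "k x = floor_log (children q F' J x)" for x
  have pos: "children q F' J x > 0" if "x \<in> F'" for x
    using that fin by (auto simp: children_def card_gt_0_iff)
  have "children q F' J x < 2 ^ L" for x
  proof -
    have "children q F' J x \<le> card {y\<in>F'. q (Suc J) y = q (Suc J) x}"
      unfolding children_def using fin by (intro card_image_le) auto
    also have "\<dots> \<le> card F" using F' assms by (intro card_mono) auto
    finally show ?thesis using assms by simp
  qed
  then have "k x < L" if "x \<in> F'" for x
    using pos[OF that] unfolding k_def
    by (metis floor_log_exp2_le le_less_trans power_less_imp_less_exp one_less_numeral_iff semiring_norm(76))
  moreover have "{..<L} \<noteq> {}" using calculation F' by (metis ex_in_conv lessThan_iff)
  ultimately obtain c where c: "c \<in> {..<L}" "card F' \<le> card {x\<in>F'. k x = c} * card {..<L}"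
    using pigeonhole_popular[of F' k "{..<L}"] fin by blast
  define F'' where "F'' = {x\<in>F'. k x = c}"
  have same: "children q F'' j x = children q F' j x" if "j \<le> J" "x \<in> F''" for j x
    by (rule children_saturated[where k="Suc J"]) (use that in \<open>auto simp: F''_def k_def children_def\<close>)
  have "card F' > 0" using fin F' by (simp add: card_gt_0_iff)
  then have "F'' \<noteq> {}" using c by (auto simp: F''_def[symmetric])
  moreover have "card F \<le> card F'' * L ^ Suc J"
  proof -
    have "card F \<le> (card F'' * L) * L ^ J" using F' c by (metis F''_def card_lessThan le_trans mult_le_mono1)
    then show ?thesis by (simp add: algebra_simps)
  qed
  moreover have "2 ^ c \<le> children q F'' J x \<and> children q F'' J x \<le> 2 * 2 ^ c" if "x \<in> F''" for x
  proof -
    have x: "x \<in> F'" "floor_log (children q F' J x) = c" using that by (auto simp: F''_def k_def)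
    show ?thesis using floor_log_exp2_le[OF pos[OF x(1)]] floor_log_exp2_gt[of "children q F' J x"]
        same[OF _ that, of J] x by simp
  qed
  moreover have "F'' \<subseteq> F'" by (auto simp: F''_def)
  ultimately show ?case
    using D same F'
    by (intro exI[of _ F''] conjI exI[of _ "D(J := 2 ^ c)"]) (auto simp: less_Suc_eq)
qed

lemma prune_children:
  assumes "finite F" "\<And>j x. j < J \<Longrightarrow> x \<in> F \<Longrightarrow> d j \<le> children q F j x"
    "\<And>j. j < J \<Longrightarrow> 1 \<le> d j"
  shows "\<exists>E\<subseteq>F. q J ` E = q J ` F \<and> (\<forall>j<J. \<forall>x\<in>E. children q E j x = d j)"
  using assms(2,3)
proof (induction J)
  case (Suc J)
  then obtain E where E: "E \<subseteq> F" "q J ` E = q J ` F" "\<And>j x. j < J \<Longrightarrow> x \<in> E \<Longrightarrow> children q E j x = d j"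
    by (metis less_SucI)
  have levelE: "q J ` {y\<in>E. q (Suc J) y = v} = q J ` {y\<in>F. q (Suc J) y = v}" for v
  proof
    show "q J ` {y\<in>F. q (Suc J) y = v} \<subseteq> q J ` {y\<in>E. q (Suc J) y = v}"
    proof (rule image_subsetI)
      fix y assume y: "y \<in> {y\<in>F. q (Suc J) y = v}"
      then have "q J y \<in> q J ` E" using E(2) by blast
      then obtain z where z: "z \<in> E" "q J y = q J z" by blast
      then show "q J y \<in> q J ` {y\<in>E. q (Suc J) y = v}" using coarser[of J y z] y by auto
    qed
  qed (use E(1) in auto)
  have "\<exists>C. C \<subseteq> q J ` {y\<in>E. q (Suc J) y = v} \<and> card C = d J" if "v \<in> q (Suc J) ` F" for v
  proof -
    have "d J \<le> card (q J ` {y\<in>F. q (Suc J) y = v})"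
      using that Suc.prems(1)[of J] by (auto simp: children_def)
    then obtain C where "C \<subseteq> q J ` {y\<in>F. q (Suc J) y = v}" "card C = d J"
      by (rule obtain_subset_with_card_n)
    then show ?thesis unfolding levelE by blast
  qed
  then have "\<exists>C. \<forall>v\<in>q (Suc J) ` F. C v \<subseteq> q J ` {y\<in>E. q (Suc J) y = v} \<and> card (C v) = d J"
    by (intro bchoice) blast
  then obtain C where C: "\<And>v. v \<in> q (Suc J) ` F \<Longrightarrow> C v \<subseteq> q J ` {y\<in>E. q (Suc J) y = v}"
    "\<And>v. v \<in> q (Suc J) ` F \<Longrightarrow> card (C v) = d J" by blast
  define E' where "E' = {x\<in>E. q J x \<in> C (q (Suc J) x)}"
  have sub: "E' \<subseteq> E" by (auto simp: E'_def)
  have low: "children q E' j x = d j" if "j < J" "x \<in> E'" for j x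
  proof -
    have "children q E' j x = children q E j x"
    proof (rule children_saturated[OF sub that(2,1)])
      show "z \<in> E'" if "y \<in> E'" "z \<in> E" "q J y = q J z" for y z
        using that coarser[of J y z] by (simp add: E'_def)
    qed
    also have "\<dots> = d j" using E(3) that sub by blast
    finally show ?thesis .
  qed
  have lev: "q J ` {y\<in>E'. q (Suc J) y = v} = C v" if "v \<in> q (Suc J) ` F" for v
    using C(1)[OF that] by (fastforce simp: E'_def)
  have "q (Suc J) ` E' = q (Suc J) ` F"
  proof
    show "q (Suc J) ` F \<subseteq> q (Suc J) ` E'"
    proof
      fix v assume v: "v \<in> q (Suc J) ` F"
      have "C v \<noteq> {}" using C(2)[OF v] Suc.prems(2)[of J] by force
      then show "v \<in> q (Suc J) ` E'" using lev[OF v] by auto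
    qed
  qed (use sub E in auto)
  moreover have "children q E' J x = d J" if "x \<in> E'" for x
    using lev[of "q (Suc J) x"] C(2)[of "q (Suc J) x"] that sub E(1) by (auto simp: children_def)
  ultimately show ?case using low sub E(1) by (intro exI[of _ E']) (auto simp: less_Suc_eq)
qed auto

text \<open>In a tree where all nodes of height \<open>j + 1\<close> have about \<open>D j\<close> children, keeping about \<open>D j powr lam\<close>
  of them at every node raises the number of nodes of every level to the power \<open>lam\<close> at once, because these numbers are
  products of the \<open>D j\<close>. An arbitrary choice of the right number of leaves would not do: it may leave the
  levels far from the leaves as populated as before. The factors \<open>2\<close> come from
  rounding and from the dyadic classes.\<close>

lemma thin_tree:
  assumes "finite F" "F \<noteq> {}" "card F < 2 ^ L" "inj_on (q 0) F"
    and root: "\<forall>x\<in>F. \<forall>y\<in>F. q J x = q J y"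
    and lam: "0 \<le> lam" "lam \<le> 1"
  shows "\<exists>E\<subseteq>F. E \<noteq> {} \<and> (\<forall>j\<le>J. real (card (q j ` E)) \<le> 2 ^ J * real (card (q j ` F)) powr lam) \<and>
    (real (card F) / (2 * L) ^ J) powr lam \<le> card E"
proof -
  obtain F' D where F': "F' \<subseteq> F" "F' \<noteq> {}" "card F \<le> card F' * L ^ J"
    and D: "\<And>j. j < J \<Longrightarrow> 1 \<le> D j"
      "\<And>j x. j < J \<Longrightarrow> x \<in> F' \<Longrightarrow> D j \<le> children q F' j x"
      "\<And>j x. j < J \<Longrightarrow> x \<in> F' \<Longrightarrow> children q F' j x \<le> 2 * D j"
    using homogeneous_subset[OF assms(1-3), of J] by blast
  have fin: "finite F'" using F' assms finite_subset by blast
  define d where "d j = nat \<lceil>real (D j) powr lam\<rceil>" for j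
  have d_lower: "real (D j) powr lam \<le> d j" for j by (simp add: d_def)
  have d1: "1 \<le> d j" and dD: "d j \<le> D j" and d_upper: "real (d j) \<le> 2 * real (D j) powr lam"
    if "j < J" for j
  proof -
    have 1: "1 \<le> real (D j) powr lam" using D(1)[OF that] lam by (intro ge_one_powr_ge_zero) auto
    then show "1 \<le> d j" by (simp add: d_def) linarith
    have "real (D j) powr lam \<le> real (D j) powr 1" using D(1)[OF that] lam by (intro powr_mono) auto
    then have "real (D j) powr lam \<le> D j" by simp
    then show "d j \<le> D j" by (simp add: d_def ceiling_le_iff)
    show "real (d j) \<le> 2 * real (D j) powr lam" using 1 unfolding d_def by linarith
  qed
  have "\<exists>E\<subseteq>F'. q J ` E = q J ` F' \<and> (\<forall>j<J. \<forall>x\<in>E. children q E j x = d j)"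
  proof (rule prune_children[OF fin])
    show "d j \<le> children q F' j x" if "j < J" "x \<in> F'" for j x
      using le_trans[OF dD D(2)] that by blast
  qed (use d1 in auto)
  then obtain E where E1: "E \<subseteq> F'" "q J ` E = q J ` F' \<and> (\<forall>j<J. \<forall>x\<in>E. children q E j x = d j)"
    by (elim exE conjE) (rule that, auto)
  then have E: "E \<subseteq> F'" "q J ` E = q J ` F'" "\<And>j x. j < J \<Longrightarrow> x \<in> E \<Longrightarrow> children q E j x = d j"
    by auto
  have finE: "finite E" using E(1) fin finite_subset by blast
  obtain x where x: "x \<in> F'" using F' by blast
  have root1: "q J ` F' = {q J x}" using root F'(1) x by blast
  have prodD: "real (\<Prod>j=l..<J. D j) powr lam = (\<Prod>j=l..<J. real (D j) powr lam)" for l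
    by (simp add: prod_powr_distrib)
  have up: "real (card (q j ` E)) \<le> 2 ^ J * real (card (q j ` F)) powr lam" if "j \<le> J" for j
  proof -
    have "card (q j ` E) \<le> (\<Prod>i=j..<J. d i)"
      using card_level_le[OF finE, of J d j] E(3) that root1 E(2) by simp
    then have "real (card (q j ` E)) \<le> (\<Prod>i=j..<J. real (d i))" by (metis of_nat_le_iff of_nat_prod)
    also have "\<dots> \<le> (\<Prod>i=j..<J. 2 * real (D i) powr lam)"
      using d_upper by (intro prod_mono) auto
    also have "\<dots> = 2 ^ (J - j) * real (\<Prod>i=j..<J. D i) powr lam"
      unfolding prodD by (simp add: prod.distrib)
    also have "\<dots> \<le> 2 ^ J * real (card (q j ` F)) powr lam"
    proof (intro mult_mono powr_mono2)
      have "(\<Prod>i=j..<J. D i) \<le> card (q j ` F')"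
        using card_level_ge[OF fin, of J D j] D(2) that root1 by simp
      also have "\<dots> \<le> card (q j ` F)" using F'(1) assms(1) by (intro card_mono) auto
      finally show "real (\<Prod>i=j..<J. D i) \<le> real (card (q j ` F))" by (simp only: of_nat_le_iff)
    qed (use lam in \<open>auto intro!: power_increasing prod_nonneg\<close>)
    finally show ?thesis .
  qed
  have "(real (card F) / (2 * L) ^ J) powr lam \<le> real (\<Prod>i=0..<J. D i) powr lam"
  proof (intro powr_mono2)
    have "card F' = card (q 0 ` F')" using assms(4) F'(1) by (metis card_image inj_on_subset)
    also have "\<dots> \<le> (\<Prod>i=0..<J. 2 * D i)"
      using card_level_le[OF fin, of J "\<lambda>i. 2 * D i" 0] D(3) root1 by simp
    also have "\<dots> = 2 ^ J * (\<Prod>i=0..<J. D i)" by (simp add: prod.distrib)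
    finally have "card F \<le> (2 ^ J * (\<Prod>i=0..<J. D i)) * L ^ J"
      using F'(3) by (meson le_trans mult_le_mono1)
    then have "real (card F) \<le> real ((2 ^ J * (\<Prod>i=0..<J. D i)) * L ^ J)" by (simp only: of_nat_le_iff)
    also have "\<dots> = real (\<Prod>i=0..<J. D i) * (2 * L) ^ J" by (simp add: power_mult_distrib)
    finally have *: "real (card F) \<le> real (\<Prod>i=0..<J. D i) * (2 * L) ^ J" .
    have "J = 0 \<or> L > 0" using F'(3) assms(1,2) by (metis card_0_eq gr0I le_zero_eq mult_0_right power_0_left)
    then have "real ((2 * L) ^ J) > 0" by auto
    with * show "real (card F) / real ((2 * L) ^ J) \<le> real (\<Prod>i=0..<J. D i)" by (simp add: divide_le_eq)
  qed (use lam in auto)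
  also have "\<dots> \<le> (\<Prod>i=0..<J. real (d i))"
    unfolding prodD using d_lower by (intro prod_mono) auto
  also have "\<dots> = real (\<Prod>i=0..<J. d i)" by simp
  also have "\<dots> \<le> card (q 0 ` E)"
    using card_level_ge[OF finE, of J d 0] E(2,3) root1 by (simp only: of_nat_le_iff) simp
  also have "\<dots> \<le> card E" using finE by (simp add: card_image_le)
  finally have "(real (card F) / (2 * L) ^ J) powr lam \<le> card E" .
  moreover have "E \<noteq> {}" using E(2) root1 by auto
  ultimately show ?thesis using up E(1) F'(1) by blast
qed

end

section \<open>Separated sets and their growth\<close>

lemma eventually_linear_power_le_exp:
  fixes A B d :: real
  assumes "d > 0" "A \<ge> 0" "B \<ge> 0"
  shows "\<forall>\<^sub>F m in sequentially. (A * real m + B) ^ J \<le> exp (d * real m)"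
proof -
  define C where "C = A + B + 1"
  have C: "C > 0" using assms by (simp add: C_def)
  have "filterlim (\<lambda>m. d * real m) at_top sequentially"
    using assms by (intro filterlim_tendsto_pos_mult_at_top[OF tendsto_const] filterlim_real_sequentially)
  then have "(\<lambda>m. (d * real m) ^ J / exp (d * real m)) \<longlonglongrightarrow> 0"
    by (rule filterlim_compose[OF tendsto_power_div_exp_0])
  then have "\<forall>\<^sub>F m in sequentially. (d * real m) ^ J / exp (d * real m) < (d / C) ^ J"
    using assms C by (intro order_tendstoD) auto
  then show ?thesis
    using eventually_ge_at_top[of 1]
  proof eventually_elim
    case (elim m)
    have "(A * real m + B) ^ J \<le> (C * real m) ^ J"
    proof (rule power_mono)
      have "B * 1 \<le> B * real m" using elim assms by (intro mult_left_mono) auto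
      then show "A * real m + B \<le> C * real m" by (simp add: C_def algebra_simps)
    qed (use assms in auto)
    also have "\<dots> = (C / d) ^ J * (d * real m) ^ J"
      using assms by (simp add: power_mult_distrib[symmetric])
    also have "\<dots> \<le> (C / d) ^ J * ((d / C) ^ J * exp (d * real m))"
      using elim assms C by (intro mult_left_mono) (auto simp: divide_less_eq)
    also have "\<dots> = exp (d * real m)"
      using assms C by (simp add: power_mult_distrib[symmetric] mult.assoc[symmetric])
    finally show ?case .
  qed
qed

lemma eventually_const_le_linear:
  fixes p C :: real assumes "0 < p"
  shows "\<forall>\<^sub>F n in sequentially. C \<le> p * real n"
proof -
  have "filterlim (\<lambda>n. p * real n) at_top sequentially"
    using assms by (intro filterlim_tendsto_pos_mult_at_top[OF tendsto_const] filterlim_real_sequentially)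
  then show ?thesis by (simp add: filterlim_at_top)
qed

definition bowen_close :: "('a::metric_space \<Rightarrow> 'a) \<Rightarrow> nat \<Rightarrow> real \<Rightarrow> 'a \<Rightarrow> 'a \<Rightarrow> bool" where
  "bowen_close T n e x y \<longleftrightarrow> (\<forall>i<n. dist ((T ^^ i) x) ((T ^^ i) y) \<le> e)"

definition bowen_separated :: "('a::metric_space \<Rightarrow> 'a) \<Rightarrow> nat \<Rightarrow> real \<Rightarrow> 'a set \<Rightarrow> bool" where
  "bowen_separated T n e G \<longleftrightarrow> (\<forall>x\<in>G. \<forall>y\<in>G. bowen_close T n e x y \<longrightarrow> x = y)"

text \<open>This says that the topological entropy of \<open>A\<close> is at most \<open>a\<close>, in terms of separated sets (Bowen's
  description). The cardinality bound is required of all finite separated sets rather than of a maximal cardinality, so that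
  monotonicity in \<open>A\<close> is immediate and no number has to be defined.\<close>

definition growth_le :: "('a::metric_space \<Rightarrow> 'a) \<Rightarrow> real \<Rightarrow> 'a set \<Rightarrow> bool" where
  "growth_le T a A \<longleftrightarrow> (\<forall>e>0. \<forall>d>0. \<exists>M. \<forall>m\<ge>M. \<forall>G\<subseteq>A. finite G \<longrightarrow> bowen_separated T m e G \<longrightarrow>
     real (card G) \<le> exp ((a + d) * real m))"

lemma bowen_close_refl: "0 \<le> e \<Longrightarrow> bowen_close T n e x x"
  by (simp add: bowen_close_def)

lemma bowen_close_sym: "bowen_close T n e x y \<Longrightarrow> bowen_close T n e y x"
  by (simp add: bowen_close_def dist_commute)

lemma bowen_close_trans:
  "bowen_close T n d x y \<Longrightarrow> bowen_close T n e y z \<Longrightarrow> bowen_close T n (d + e) x z"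
  unfolding bowen_close_def by (meson add_mono dist_triangle order_trans)

lemma bowen_close_mono:
  "bowen_close T n d x y \<Longrightarrow> m \<le> n \<Longrightarrow> d \<le> e \<Longrightarrow> bowen_close T m e x y"
  unfolding bowen_close_def by (meson less_le_trans order_trans)

lemma bowen_separated_subset: "bowen_separated T n e G \<Longrightarrow> F \<subseteq> G \<Longrightarrow> bowen_separated T n e F"
  unfolding bowen_separated_def by blast

lemma bowen_separated_mono:
  "bowen_separated T m e G \<Longrightarrow> m \<le> n \<Longrightarrow> d \<le> e \<Longrightarrow> bowen_separated T n d G"
  unfolding bowen_separated_def by (meson bowen_close_mono)

text \<open>A cover by sets of small Bowen diameter bounds the size of separated sets. The cover is given as a map to an
  index set, which suits the projections of a tree, whose fibres are such sets.\<close>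

lemma bowen_separated_card_le:
  assumes "bowen_separated T n e G" "finite C" "\<And>x. x \<in> G \<Longrightarrow> f x \<in> C"
    "\<And>x y. x \<in> G \<Longrightarrow> y \<in> G \<Longrightarrow> f x = f y \<Longrightarrow> bowen_close T n e x y"
  shows "card G \<le> card C"
proof (rule card_inj_on_le)
  show "inj_on f G" using assms(1,4) unfolding bowen_separated_def inj_on_def by blast
qed (use assms in auto)

lemma growth_le_subset: "growth_le T a A \<Longrightarrow> B \<subseteq> A \<Longrightarrow> growth_le T a B"
  unfolding growth_le_def by (meson subset_trans)

lemma growth_le_mono:
  assumes "growth_le T a A" "a \<le> b" shows "growth_le T b A"
  unfolding growth_le_def
proof (intro allI impI)
  fix e d :: real assume "0 < e" "0 < d"
  then obtain M where M: "\<And>m G. m \<ge> M \<Longrightarrow> G \<subseteq> A \<Longrightarrow> finite G \<Longrightarrow> bowen_separated T m e G \<Longrightarrow>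
      real (card G) \<le> exp ((a + d) * real m)"
    using assms(1) unfolding growth_le_def by metis
  have "exp ((a + d) * real m) \<le> exp ((b + d) * real m)" for m
    using assms(2) by (simp add: mult_right_mono)
  then show "\<exists>M. \<forall>m\<ge>M. \<forall>G\<subseteq>A. finite G \<longrightarrow> bowen_separated T m e G \<longrightarrow> real (card G) \<le> exp ((b + d) * real m)"
    using M by (meson order_trans)
qed

lemma not_growth_leE:
  assumes "\<not> growth_le T a A"
  obtains e d where "e > 0" "d > 0"
    "\<And>M. \<exists>m\<ge>M. \<exists>G\<subseteq>A. finite G \<and> bowen_separated T m e G \<and> exp ((a + d) * real m) < real (card G)"
  using assms unfolding growth_le_def by (metis not_le)

lemma growth_le_nonneg:
  assumes "growth_le T a A" "A \<noteq> {}"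
  shows "0 \<le> a"
proof (rule ccontr)
  assume "\<not> 0 \<le> a"
  then have "0 < - a / 2" by simp
  then obtain M where M: "\<And>m G. m \<ge> M \<Longrightarrow> G \<subseteq> A \<Longrightarrow> finite G \<Longrightarrow> bowen_separated T m 1 G \<Longrightarrow>
      real (card G) \<le> exp ((a + - a / 2) * real m)"
    using assms(1) unfolding growth_le_def by (metis zero_less_one)
  obtain x where "x \<in> A" using assms by blast
  then have "1 \<le> exp ((a + - a / 2) * real (Suc M))"
    using M[of "Suc M" "{x}"] by (simp add: bowen_separated_def)
  then have "0 \<le> (a + - a / 2) * real (Suc M)" by simp
  then show False using \<open>0 < - a / 2\<close> by (simp add: zero_le_mult_iff)
qed

lemma growth_le_finite:
  assumes "finite A" "0 \<le> a"
  shows "growth_le T a A"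
  unfolding growth_le_def
proof (intro allI impI)
  fix e d :: real assume "0 < e" "0 < d"
  obtain M where M: "real (card A) \<le> real M * d" using reals_Archimedean3[OF \<open>0 < d\<close>] less_imp_le by blast
  have "real (card G) \<le> exp ((a + d) * real m)" if "M \<le> m" "G \<subseteq> A" for m G
  proof -
    have "real (card G) \<le> real (card A)" using that assms by (simp add: card_mono)
    also have "\<dots> \<le> real m * d" using M that \<open>0 < d\<close> by (meson less_imp_le mult_right_mono of_nat_mono order_trans)
    also have "\<dots> \<le> (a + d) * real m" using assms by (simp add: algebra_simps)
    also have "\<dots> \<le> exp ((a + d) * real m)" using exp_ge_add_one_self[of "(a + d) * real m"] by linarith
    finally show ?thesis .
  qed
  then show "\<exists>M. \<forall>m\<ge>M. \<forall>G\<subseteq>A. finite G \<longrightarrow> bowen_separated T m e G \<longrightarrow> real (card G) \<le> exp ((a + d) * real m)"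
    by blast
qed

lemma growth_le_finite_Union:
  assumes "finite P" "\<And>B. B \<in> P \<Longrightarrow> growth_le T a B"
  shows "growth_le T a (\<Union>P)"
  unfolding growth_le_def
proof (intro allI impI)
  fix e d :: real assume "0 < e" "0 < d"
  then have "\<exists>M. \<forall>m\<ge>M. \<forall>G\<subseteq>B. finite G \<longrightarrow> bowen_separated T m e G \<longrightarrow>
      real (card G) \<le> exp ((a + d/2) * real m)" if "B \<in> P" for B
    using assms(2)[OF that] unfolding growth_le_def by (metis half_gt_zero)
  then obtain M where M: "\<And>B m G. B \<in> P \<Longrightarrow> m \<ge> M B \<Longrightarrow> G \<subseteq> B \<Longrightarrow> finite G \<Longrightarrow> bowen_separated T m e G \<Longrightarrow>
      real (card G) \<le> exp ((a + d/2) * real m)" by metis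
  obtain M' where M': "\<And>m. m \<ge> M' \<Longrightarrow> real (card P) \<le> exp (d/2 * real m)"
    using eventually_linear_power_le_exp[of "d/2" 0 "card P" 1] \<open>0 < d\<close>
    by (auto simp: eventually_sequentially)
  have "real (card G) \<le> exp ((a + d) * real m)"
    if m: "m \<ge> Max (insert M' (M ` P))" and G: "G \<subseteq> \<Union>P" "finite G" "bowen_separated T m e G" for m G
  proof -
    have mM: "m \<ge> M'" "\<And>B. B \<in> P \<Longrightarrow> m \<ge> M B" using m assms(1) by auto
    have "G = (\<Union>B\<in>P. G \<inter> B)" using G by auto
    then have "card G \<le> (\<Sum>B\<in>P. card (G \<inter> B))" using card_UN_le[OF assms(1), of "\<lambda>B. G \<inter> B"] by simp
    then have "real (card G) \<le> (\<Sum>B\<in>P. real (card (G \<inter> B)))" by (metis of_nat_le_iff of_nat_sum)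
    also have "\<dots> \<le> (\<Sum>B\<in>P. exp ((a + d/2) * real m))"
      using mM G by (intro sum_mono M) (auto intro: bowen_separated_subset)
    also have "\<dots> = real (card P) * exp ((a + d/2) * real m)" by simp
    also have "\<dots> \<le> exp (d/2 * real m) * exp ((a + d/2) * real m)" using M' mM by simp
    also have "\<dots> = exp ((a + d) * real m)" by (simp add: exp_add[symmetric] algebra_simps)
    finally show ?thesis .
  qed
  then show "\<exists>M. \<forall>m\<ge>M. \<forall>G\<subseteq>\<Union>P. finite G \<longrightarrow> bowen_separated T m e G \<longrightarrow> real (card G) \<le> exp ((a + d) * real m)"
    by blast
qed

text \<open>A separated set of largest cardinality cannot be enlarged, so every point of \<open>A\<close> is close to
  one of its points.\<close>

lemma maximal_separated_spans:
  assumes "0 \<le> e" and B: "\<And>G. G \<subseteq> A \<Longrightarrow> finite G \<Longrightarrow> bowen_separated T n e G \<Longrightarrow> real (card G) \<le> B"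
  obtains S where "S \<subseteq> A" "finite S" "bowen_separated T n e S" "\<And>x. x \<in> A \<Longrightarrow> \<exists>s\<in>S. bowen_close T n e x s"
proof -
  define P where "P S \<longleftrightarrow> S \<subseteq> A \<and> finite S \<and> bowen_separated T n e S" for S
  have "card G < nat \<lceil>B\<rceil> + 1" if "P G" for G
    using B[of G] that unfolding P_def by linarith
  moreover have "P {}" by (simp add: P_def bowen_separated_def)
  ultimately obtain S where S: "P S" "\<And>G. P G \<Longrightarrow> card G \<le> card S"
    using ex_has_greatest_nat[of P "{}" card] by blast
  have "\<exists>s\<in>S. bowen_close T n e x s" if "x \<in> A" for x
  proof (rule ccontr)
    assume no: "\<not> ?thesis"
    then have "x \<notin> S" using bowen_close_refl[OF assms(1)] by blast
    have "P (insert x S)" using S(1) no that bowen_close_sym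
      unfolding P_def bowen_separated_def by (simp, blast)
    then have "card (insert x S) \<le> card S" using S(2) by blast
    then show False using \<open>x \<notin> S\<close> S(1) by (simp add: P_def)
  qed
  then show ?thesis using that S(1) unfolding P_def by blast
qed

lemma funpow_mem: "T ` X \<subseteq> X \<Longrightarrow> x \<in> X \<Longrightarrow> (T ^^ i) x \<in> X"
  by (induction i) auto

lemma continuous_on_funpow:
  assumes "continuous_on X T" "T ` X \<subseteq> X"
  shows "continuous_on X (T ^^ i)"
proof (induction i)
  case (Suc i)
  then have "continuous_on X (T \<circ> (T ^^ i))"
    using assms funpow_mem[OF assms(2)] by (intro continuous_on_compose continuous_on_subset[OF assms(1)]) auto
  then show ?case by simp
qed (simp add: continuous_on_id id_def)

lemma bowen_close_uniform:
  assumes "compact X" "continuous_on X T" "T ` X \<subseteq> X" "0 < e"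
  shows "\<exists>d>0. \<forall>x\<in>X. \<forall>y\<in>X. dist x y < d \<longrightarrow> bowen_close T n e x y"
proof (induction n)
  case 0
  show ?case by (rule exI[of _ 1]) (simp add: bowen_close_def)
next
  case (Suc n)
  then obtain d where d: "d > 0" "\<forall>x\<in>X. \<forall>y\<in>X. dist x y < d \<longrightarrow> bowen_close T n e x y" by blast
  have "uniformly_continuous_on X (T ^^ n)"
    using assms by (intro compact_uniformly_continuous continuous_on_funpow)
  then obtain d' where d': "d' > 0" "\<forall>x\<in>X. \<forall>y\<in>X. dist y x < d' \<longrightarrow> dist ((T ^^ n) y) ((T ^^ n) x) < e"
    unfolding uniformly_continuous_on_def using assms(4) by blast
  show ?case
  proof (intro exI[of _ "min d d'"] conjI ballI impI)
    fix x y assume "x \<in> X" "y \<in> X" "dist x y < min d d'"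
    then show "bowen_close T (Suc n) e x y"
      using d d' unfolding bowen_close_def by (auto simp: less_Suc_eq less_imp_le)
  qed (use d d' in auto)
qed

section \<open>Entropy in terms of separated sets\<close>

lemma cover_number_le:
  "\<F> \<subseteq> \<V> \<Longrightarrow> finite \<F> \<Longrightarrow> A \<subseteq> \<Union>\<F> \<Longrightarrow> cover_number \<V> A \<le> card \<F>"
  unfolding cover_number_def by (rule Least_le) blast

lemma cover_number_attained:
  assumes "\<F> \<subseteq> \<V>" "finite \<F>" "A \<subseteq> \<Union>\<F>"
  obtains \<G> where "\<G> \<subseteq> \<V>" "finite \<G>" "A \<subseteq> \<Union>\<G>" "card \<G> = cover_number \<V> A"
  using LeastI[of "\<lambda>m. \<exists>\<F>\<subseteq>\<V>. finite \<F> \<and> card \<F> = m \<and> A \<subseteq> \<Union>\<F>" "card \<F>"] assms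
  unfolding cover_number_def by blast

lemma finite_cover_join:
  assumes "finite \<U>" shows "finite (cover_join X T \<U> n)"
proof (rule finite_subset)
  show "cover_join X T \<U> n \<subseteq> (\<lambda>V. X \<inter> (\<Inter>i<n. (T ^^ i) -` V i)) ` ({..<n} \<rightarrow>\<^sub>E \<U>)"
  proof
    fix W assume "W \<in> cover_join X T \<U> n"
    then obtain V where V: "W = X \<inter> (\<Inter>i<n. (T ^^ i) -` V i)" "\<forall>i<n. V i \<in> \<U>"
      unfolding cover_join_def by blast
    then have "W = X \<inter> (\<Inter>i<n. (T ^^ i) -` restrict V {..<n} i)" by auto
    then show "W \<in> (\<lambda>V. X \<inter> (\<Inter>i<n. (T ^^ i) -` V i)) ` ({..<n} \<rightarrow>\<^sub>E \<U>)"
      using V(2) by (intro image_eqI[of _ _ "restrict V {..<n}"]) auto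
  qed
qed (use assms in \<open>auto intro: finite_PiE\<close>)

lemma Union_cover_join:
  assumes "\<Union>\<U> = X" "T ` X \<subseteq> X" shows "X \<subseteq> \<Union>(cover_join X T \<U> n)"
proof
  fix x assume x: "x \<in> X"
  have "\<forall>i. \<exists>U\<in>\<U>. (T ^^ i) x \<in> U" using funpow_mem[OF assms(2) x] assms(1) by blast
  then obtain V where V: "\<And>i. V i \<in> \<U>" "\<And>i. (T ^^ i) x \<in> V i" by metis
  have "X \<inter> (\<Inter>i<n. (T ^^ i) -` V i) \<in> cover_join X T \<U> n" using V(1) by (auto simp: cover_join_def)
  moreover have "x \<in> X \<inter> (\<Inter>i<n. (T ^^ i) -` V i)" using V(2) x by auto
  ultimately show "x \<in> \<Union>(cover_join X T \<U> n)" by blast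
qed

lemma Lebesgue_number_finite_open_cover:
  assumes "compact X" "finite_open_cover X \<U>"
  obtains e where "e > 0" "\<And>x. x \<in> X \<Longrightarrow> \<exists>U\<in>\<U>. X \<inter> ball x e \<subseteq> U"
proof -
  have "\<forall>U\<in>\<U>. \<exists>W. open W \<and> U = X \<inter> W"
    using assms(2) unfolding finite_open_cover_def by (simp add: openin_open)
  then obtain W where W: "\<And>U. U \<in> \<U> \<Longrightarrow> open (W U) \<and> U = X \<inter> W U" by metis
  have "X \<subseteq> \<Union>(W ` \<U>)" using W assms(2) unfolding finite_open_cover_def by blast
  then obtain e where e: "e > 0" "\<And>x. x \<in> X \<Longrightarrow> \<exists>G\<in>W ` \<U>. ball x e \<subseteq> G"
    using Heine_Borel_lemma[OF assms(1), of "W ` \<U>"] W by blast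
  show ?thesis
  proof (rule that[OF e(1)])
    fix x assume "x \<in> X"
    then obtain U where "U \<in> \<U>" "ball x e \<subseteq> W U" using e(2) by blast
    then show "\<exists>U\<in>\<U>. X \<inter> ball x e \<subseteq> U" using W by blast
  qed
qed

text \<open>Below the Lebesgue number of a cover, each Bowen ball lies in a member of the joined cover; hence a maximal
  separated set, whose balls cover \<open>A\<close>, bounds the covering number.\<close>

lemma entropy_le_of_growth_le:
  assumes X: "compact X" "T ` X \<subseteq> X" and A: "A \<subseteq> X" "growth_le T a A" and "0 \<le> a"
  shows "entropy X T A \<le> ereal a"
  unfolding entropy_def
proof (rule SUP_least)
  fix \<U> assume "\<U> \<in> {\<U>. finite_open_cover X \<U>}"
  then have \<U>: "finite_open_cover X \<U>" by simp
  obtain e where e: "e > 0" "\<And>x. x \<in> X \<Longrightarrow> \<exists>U\<in>\<U>. X \<inter> ball x e \<subseteq> U"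
    using Lebesgue_number_finite_open_cover[OF X(1) \<U>] by blast
  show "cover_entropy X T \<U> A \<le> ereal a"
  proof (rule ereal_le_epsilon2)
    fix d :: real assume "0 < d"
    obtain M where M: "\<And>m G. m \<ge> M \<Longrightarrow> G \<subseteq> A \<Longrightarrow> finite G \<Longrightarrow> bowen_separated T m (e/2) G \<Longrightarrow>
        real (card G) \<le> exp ((a + d) * real m)"
      using A(2) e(1) \<open>0 < d\<close> unfolding growth_le_def by (metis half_gt_zero)
    have bound: "1 / real n * ln (real (cover_number (cover_join X T \<U> n) A)) \<le> a + d" if n: "n \<ge> max M 1" for n
    proof -
      have "n \<ge> M" using n by simp
      obtain S where S: "S \<subseteq> A" "finite S" "bowen_separated T n (e/2) S"
        "\<And>x. x \<in> A \<Longrightarrow> \<exists>s\<in>S. bowen_close T n (e/2) x s"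
        using maximal_separated_spans[of "e/2" A T n, OF _ M[OF \<open>n \<ge> M\<close>]] e(1) by auto
      have "\<forall>x\<in>X. \<exists>U\<in>\<U>. X \<inter> ball x e \<subseteq> U" using e(2) by blast
      then obtain U where U: "\<And>x. x \<in> X \<Longrightarrow> U x \<in> \<U>" "\<And>x. x \<in> X \<Longrightarrow> X \<inter> ball x e \<subseteq> U x" by metis
      define V where "V s = X \<inter> (\<Inter>i<n. (T ^^ i) -` U ((T ^^ i) s))" for s
      have "cover_number (cover_join X T \<U> n) A \<le> card (V ` S)"
      proof (rule cover_number_le)
        show "V ` S \<subseteq> cover_join X T \<U> n"
        proof (rule image_subsetI)
          fix s assume "s \<in> S"
          then have "s \<in> X" using S(1) A(1) by blast
          then have "U ((T ^^ i) s) \<in> \<U>" for i by (intro U(1) funpow_mem[OF X(2)])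
          then show "V s \<in> cover_join X T \<U> n"
            unfolding V_def cover_join_def by (intro CollectI exI[of _ "\<lambda>i. U ((T ^^ i) s)"]) simp
        qed
        show "A \<subseteq> \<Union>(V ` S)"
        proof
          fix x assume x: "x \<in> A"
          then obtain s where s: "s \<in> S" "bowen_close T n (e/2) x s" using S(4) by blast
          have "(T ^^ i) x \<in> U ((T ^^ i) s)" if "i < n" for i
          proof -
            have "dist ((T ^^ i) s) ((T ^^ i) x) < e"
              using s(2) that e(1) unfolding bowen_close_def by (force simp: dist_commute)
            moreover have "(T ^^ i) s \<in> X" "(T ^^ i) x \<in> X"
              using s(1) S(1) A(1) x by (auto intro!: funpow_mem[OF X(2)])
            ultimately show ?thesis using U(2)[of "(T ^^ i) s"] by (simp add: subset_iff)
          qed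
          then show "x \<in> \<Union>(V ` S)" using s(1) x A(1) by (auto simp: V_def)
        qed
      qed (use S in simp)
      also have "\<dots> \<le> card S" using S(2) by (rule card_image_le)
      finally have "real (cover_number (cover_join X T \<U> n) A) \<le> real (card S)" by simp
      also have "\<dots> \<le> exp ((a + d) * real n)" using M[OF \<open>n \<ge> M\<close>] S by blast
      finally have le: "real (cover_number (cover_join X T \<U> n) A) \<le> exp ((a + d) * real n)" .
      have "ln (real (cover_number (cover_join X T \<U> n) A)) \<le> (a + d) * real n"
      \<comment> \<open>The covering number is \<open>0\<close> when \<open>A\<close> is empty; then \<open>ln 0 = 0\<close> and \<open>0 \<le> a\<close> are used.\<close>
      proof (cases "cover_number (cover_join X T \<U> n) A = 0")
        case True
        then show ?thesis using \<open>0 \<le> a\<close> \<open>0 < d\<close> by simp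
      next
        case False
        then have "ln (real (cover_number (cover_join X T \<U> n) A)) \<le> ln (exp ((a + d) * real n))"
          using le by (subst ln_le_cancel_iff) auto
        then show ?thesis by simp
      qed
      then show ?thesis using n by (simp add: field_simps)
    qed
    show "cover_entropy X T \<U> A \<le> ereal a + ereal d"
      unfolding cover_entropy_def
    proof (rule Limsup_bounded)
      show "\<forall>\<^sub>F n in sequentially. ereal (1 / real n * ln (real (cover_number (cover_join X T \<U> n) A))) \<le> ereal a + ereal d"
        using bound unfolding eventually_sequentially by (intro exI[of _ "max M 1"]) auto
    qed
  qed
qed

lemma finite_open_cover_by_balls:
  assumes "compact X" "0 < e"
  obtains \<U> where "finite_open_cover X \<U>" "\<And>U x y. U \<in> \<U> \<Longrightarrow> x \<in> U \<Longrightarrow> y \<in> U \<Longrightarrow> dist x y < e"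
proof -
  obtain C where C: "C \<subseteq> X" "finite C" "X \<subseteq> (\<Union>c\<in>C. ball c (e/2))"
    using compactE_image[OF assms(1), of X "\<lambda>c. ball c (e/2)"] assms(2) by force
  show ?thesis
  proof (rule that[of "(\<lambda>c. X \<inter> ball c (e/2)) ` C"])
    show "finite_open_cover X ((\<lambda>c. X \<inter> ball c (e/2)) ` C)"
      using C by (auto simp: finite_open_cover_def openin_open_Int)
  next
    fix U x y assume "U \<in> (\<lambda>c. X \<inter> ball c (e/2)) ` C" "x \<in> U" "y \<in> U"
    then obtain c where "dist c x < e/2" "dist c y < e/2" by auto
    then show "dist x y < e" using dist_triangle_half_r by blast
  qed
qed

text \<open>For a cover by sets of diameter less than \<open>e\<close>, a member of the joined cover contains at most one point of an
  \<open>e\<close>-separated set, so covering numbers bound separated sets.\<close>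

lemma growth_le_of_entropy_le:
  assumes X: "compact X" "T ` X \<subseteq> X" and A: "A \<subseteq> X" "entropy X T A \<le> ereal a"
  shows "growth_le T a A"
  unfolding growth_le_def
proof (intro allI impI)
  fix e d :: real assume "0 < e" "0 < d"
  obtain \<U> where \<U>: "finite_open_cover X \<U>" "\<And>U x y. U \<in> \<U> \<Longrightarrow> x \<in> U \<Longrightarrow> y \<in> U \<Longrightarrow> dist x y < e"
    using finite_open_cover_by_balls[OF X(1) \<open>0 < e\<close>] by blast
  have "cover_entropy X T \<U> A \<le> ereal a"
    using A(2) \<U>(1) unfolding entropy_def by (simp add: SUP_le_iff)
  also have "\<dots> < ereal (a + d)" using \<open>0 < d\<close> by simp
  finally have "\<forall>\<^sub>F n in sequentially. ereal (1 / real n * ln (real (cover_number (cover_join X T \<U> n) A))) < ereal (a + d)"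
    unfolding cover_entropy_def by (rule Limsup_lessD)
  then obtain M where M: "\<And>n. n \<ge> M \<Longrightarrow> 1 / real n * ln (real (cover_number (cover_join X T \<U> n) A)) < a + d"
    unfolding eventually_sequentially by auto
  have "real (card G) \<le> exp ((a + d) * real m)"
    if m: "m \<ge> max M 1" and G: "G \<subseteq> A" "finite G" "bowen_separated T m e G" for m G
  proof -
    have fin: "finite (cover_join X T \<U> m)" using \<U>(1) finite_cover_join unfolding finite_open_cover_def by blast
    have "A \<subseteq> \<Union>(cover_join X T \<U> m)"
      using Union_cover_join[of \<U> X T m] X(2) A(1) \<U>(1) unfolding finite_open_cover_def by blast
    then obtain \<G> where \<G>: "\<G> \<subseteq> cover_join X T \<U> m" "finite \<G>" "A \<subseteq> \<Union>\<G>"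
      "card \<G> = cover_number (cover_join X T \<U> m) A"
      using cover_number_attained[OF subset_refl fin] by blast
    have "\<forall>x\<in>G. \<exists>W\<in>\<G>. x \<in> W" using G(1) \<G>(3) by blast
    then obtain W where W: "\<And>x. x \<in> G \<Longrightarrow> W x \<in> \<G>" "\<And>x. x \<in> G \<Longrightarrow> x \<in> W x" by metis
    have le: "card G \<le> card \<G>"
    proof (rule bowen_separated_card_le[OF G(3) \<G>(2) W(1)])
      fix x y assume xy: "x \<in> G" "y \<in> G" "W x = W y"
      obtain V where V: "W x = X \<inter> (\<Inter>i<m. (T ^^ i) -` V i)" "\<forall>i<m. V i \<in> \<U>"
        using W(1)[OF xy(1)] \<G>(1) unfolding cover_join_def by blast
      have "x \<in> W x" "y \<in> W x" using W(2)[OF xy(1)] W(2)[OF xy(2)] xy(3) by simp_all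
      then have "(T ^^ i) x \<in> V i" "(T ^^ i) y \<in> V i" if "i < m" for i
        using that unfolding V(1) by auto
      then show "bowen_close T m e x y"
        using V(2) \<U>(2) unfolding bowen_close_def by (meson less_imp_le)
    qed
    show ?thesis
    proof (cases "card \<G> = 0")
      case True
      then show ?thesis using le by simp
    next
      case False
      then have pos: "0 < real (card \<G>)" by simp
      have "ln (real (card \<G>)) \<le> (a + d) * real m"
        using M[of m] m \<G>(4) by (simp add: field_simps)
      then have "exp (ln (real (card \<G>))) \<le> exp ((a + d) * real m)" by (simp only: exp_le_cancel_iff)
      then have "real (card \<G>) \<le> exp ((a + d) * real m)" using pos by (simp only: exp_ln)
      then show ?thesis using le by linarith
    qed
  qed
  then show "\<exists>M. \<forall>m\<ge>M. \<forall>G\<subseteq>A. finite G \<longrightarrow> bowen_separated T m e G \<longrightarrow> real (card G) \<le> exp ((a + d) * real m)"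
    by blast
qed

lemma entropy_eqI:
  assumes "compact X" "T ` X \<subseteq> X" "A \<subseteq> X" "0 \<le> a" "growth_le T a A" "\<And>b. b < a \<Longrightarrow> \<not> growth_le T b A"
  shows "entropy X T A = ereal a"
proof (rule antisym)
  show "entropy X T A \<le> ereal a" using assms by (intro entropy_le_of_growth_le)
  show "ereal a \<le> entropy X T A"
  proof (rule ccontr)
    assume "\<not> ereal a \<le> entropy X T A"
    then obtain b where b: "entropy X T A < ereal b" "ereal b < ereal a"
      using ereal_dense2[of "entropy X T A" "ereal a"] by (auto simp: not_le)
    then have "growth_le T b A" using assms by (intro growth_le_of_entropy_le[of X]) auto
    then show False using b assms(6) by simp
  qed
qed

section \<open>Thinned separated sets of a compact set\<close>

text \<open>A tree over \<open>K\<close> for the decreasing times \<open>t 0, \<dots>, t J\<close>: send a point to a nearby point of a maximal separated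
  set for time \<open>t 1\<close>, send that one to a point of such a set for \<open>t 2\<close>, and so on. Composing the projections, instead of
  projecting each point anew for every time, makes the ancestors of a point depend only on the
  node below; the price is that the errors add up, to \<open>j * e\<close> at height \<open>j\<close>. Level \<open>j\<close> has no more nodes
  than the separated set for time \<open>t j\<close>. At height \<open>0\<close> the nodes are all the points themselves.\<close>

lemma projection_tree:
  fixes t :: "nat \<Rightarrow> nat" and B :: "nat \<Rightarrow> real"
  assumes "0 \<le> e" "antimono t"
    and B: "\<And>j G. j \<le> J \<Longrightarrow> G \<subseteq> K \<Longrightarrow> finite G \<Longrightarrow> bowen_separated T (t j) e G \<Longrightarrow> real (card G) \<le> B j"
  obtains q where "leaf_tree q" "\<And>x. q 0 x = x"
    "\<And>j x. j \<le> J \<Longrightarrow> x \<in> K \<Longrightarrow> bowen_close T (t j) (real j * e) x (q j x)"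
    "\<And>j. 0 < j \<Longrightarrow> j \<le> J \<Longrightarrow> finite (q j ` K) \<and> real (card (q j ` K)) \<le> B j"
proof -
  have "\<exists>S. S \<subseteq> K \<and> finite S \<and> bowen_separated T (t j) e S \<and> (\<forall>x\<in>K. \<exists>s\<in>S. bowen_close T (t j) e x s)"
    if j: "j \<le> J" for j
  proof -
    obtain S where "S \<subseteq> K" "finite S" "bowen_separated T (t j) e S" "\<And>x. x \<in> K \<Longrightarrow> \<exists>s\<in>S. bowen_close T (t j) e x s"
      using maximal_separated_spans[of e K T "t j" "B j"] assms(1) B[OF j] by blast
    then show ?thesis by blast
  qed
  then obtain S where S: "\<And>j. j \<le> J \<Longrightarrow> S j \<subseteq> K \<and> finite (S j) \<and> bowen_separated T (t j) e (S j) \<and>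
      (\<forall>x\<in>K. \<exists>s\<in>S j. bowen_close T (t j) e x s)" by metis
  then have "\<forall>j x. \<exists>s. j \<le> J \<longrightarrow> x \<in> K \<longrightarrow> s \<in> S j \<and> bowen_close T (t j) e x s" by blast
  then obtain p where p: "\<And>j x. j \<le> J \<Longrightarrow> x \<in> K \<Longrightarrow> p j x \<in> S j \<and> bowen_close T (t j) e x (p j x)" by metis
  define q where "q j x = rec_nat x (\<lambda>j y. p (Suc j) y) j" for j x
  have q0: "q 0 x = x" and qSuc: "q (Suc j) x = p (Suc j) (q j x)" for j x by (simp_all add: q_def)
  have qK: "q j x \<in> K" if "j \<le> J" "x \<in> K" for j x
    using that(1)
  proof (induction j)
    case (Suc j)
    then have "p (Suc j) (q j x) \<in> S (Suc j)" using p by simp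
    then show ?case using S[of "Suc j"] Suc.prems by (auto simp: qSuc)
  qed (use that in \<open>simp add: q0\<close>)
  show ?thesis
  proof
    show "leaf_tree q" by unfold_locales (simp add: qSuc)
    show "q 0 x = x" for x by (rule q0)
    show "bowen_close T (t j) (real j * e) x (q j x)" if "j \<le> J" "x \<in> K" for j x
      using that(1)
    proof (induction j)
      case 0
      then show ?case by (simp add: q0 bowen_close_refl)
    next
      case (Suc j)
      have "bowen_close T (t (Suc j)) (real j * e) x (q j x)"
        using Suc assms(2) by (intro bowen_close_mono[OF Suc.IH]) (auto dest: antimonoD[of t j "Suc j"])
      then have "bowen_close T (t (Suc j)) (real j * e + e) x (q (Suc j) x)"
        using p[of "Suc j" "q j x"] qK[of j x] Suc that(2) by (auto simp: qSuc intro: bowen_close_trans)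
      then show ?case by (simp add: algebra_simps)
    qed
    show "finite (q j ` K) \<and> real (card (q j ` K)) \<le> B j" if j: "0 < j" "j \<le> J" for j
    proof -
      obtain i where i: "j = Suc i" using j(1) gr0_conv_Suc by blast
      have "q j ` K \<subseteq> S j" using p[of j] qK[of i] j(2) by (auto simp: i qSuc)
      moreover have "finite (S j)" "real (card (S j)) \<le> B j" using S[OF j(2)] B[OF j(2)] by auto
      ultimately show ?thesis by (meson card_mono finite_subset of_nat_le_iff order_trans)
    qed
  qed
qed

text \<open>Times in geometric progression control all times in between: each \<open>m\<close> beyond the smallest of them is at most
  some \<open>t j\<close> that exceeds it by a factor of at most about \<open>1 / r\<close>. Beyond the largest, \<open>t 0 = n\<close>, the index
  \<open>0\<close> serves: it belongs to the leaves, whose number bounds everything.\<close>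

lemma geometric_time_scale:
  fixes r :: real and n J m :: nat
  assumes "0 < r" "r < 1" and t: "t = (\<lambda>j. nat \<lceil>r ^ j * real n\<rceil>)" and m: "t J < m"
  obtains j where "j \<le> J" "real (t j) \<le> real m / r + 1" "j = 0 \<or> m \<le> t j"
proof -
  define k where "k = (LEAST k. t k < m)"
  have k: "t k < m" "k \<le> J" using m unfolding k_def by (auto intro: LeastI Least_le)
  have tub: "real (t j) \<le> r ^ j * real n + 1" and tlb: "r ^ j * real n \<le> real (t j)" for j
    using assms(1) unfolding t by (simp_all add: of_nat_ceiling)
  show ?thesis
  proof (cases k)
    case 0
    have "real m \<le> real m / r" using assms by (simp add: le_divide_eq mult_left_le)
    then show ?thesis using k 0 by (intro that[of 0]) auto
  next
    case (Suc j)
    have "m \<le> t j" using not_less_Least[of j "\<lambda>k. t k < m"] Suc unfolding k_def by auto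
    moreover have "r ^ j * real n \<le> real m / r"
      using tlb[of k] k(1) assms(1) by (simp add: Suc field_simps)
    then have "real (t j) \<le> real m / r + 1" using tub[of j] by linarith
    ultimately show ?thesis using Suc k(2) by (intro that[of j]) auto
  qed
qed

text \<open>The heart of the matter. There is a fixed scale \<open>e1\<close> at which \<open>K\<close> contains about \<open>exp (H * n)\<close> separated
  points for infinitely many times \<open>n\<close>, while at any finer scale and any large time \<open>m\<close> the whole of
  \<open>K\<close> contains at most about \<open>exp (H * m)\<close>. Thinning the tree of the finer scale over these points with exponent
  \<open>lam\<close> close to \<open>c / H\<close> turns both numbers into about \<open>exp (c * n)\<close> and \<open>exp (c * m)\<close>. So the thinned set is as
  large as entropy \<open>c\<close> requires at the scale \<open>e1\<close>, and not larger than entropy \<open>c\<close> permits at the finer scale at any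
  time. For times that are small compared to \<open>n\<close> the latter is achieved by first restricting to a single node at the top of the tree;
  by the choice of \<open>J\<close> this costs a factor of at most \<open>exp (d * n)\<close>.\<close>

lemma thinned_separated_sets:
  assumes up: "growth_le T H K" and low: "\<And>b. b < H \<Longrightarrow> \<not> growth_le T b K"
    and eta: "0 < eta" "eta < c" and c: "c < H"
  shows "\<exists>e1>0. \<forall>e>0. \<forall>N. \<exists>n\<ge>N. \<exists>E\<subseteq>K. finite E \<and> E \<noteq> {} \<and> bowen_separated T n e1 E \<and>
    exp ((c - eta) * real n) \<le> real (card E) \<and> (\<forall>x\<in>E. \<forall>y\<in>E. dist x y \<le> e) \<and>
    (\<forall>m. \<forall>G\<subseteq>E. bowen_separated T m e G \<longrightarrow> real (card G) \<le> exp (c * real m))"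
proof -
  have H: "0 < H" using eta c by linarith
  define lam where "lam = (c - eta/2) / H"
  have lam: "0 < lam" "lam < 1" "lam * H = c - eta/2" using eta c H by (auto simp: lam_def divide_less_eq)
  \<comment> \<open>All errors in the exponents will be multiples of \<open>d\<close>; the choice makes their sum smaller than the
    gaps that the definition of \<open>lam\<close> leaves on either side.\<close>
  define d where "d = min 1 (eta / (8 * (H + 2)))"
  have d: "0 < d" "d \<le> 1" using eta H by (auto simp: d_def)
  have d3: "d * (H + 2) \<le> eta/8"
  proof -
    have "d * (H + 2) \<le> eta / (8 * (H + 2)) * (H + 2)" using H by (intro mult_right_mono) (auto simp: d_def)
    also have "\<dots> = eta/8" using H by (simp add: divide_simps)
    finally show ?thesis .
  qed
  have d2: "3 * d \<le> eta / 2"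
  proof -
    have "d * 2 \<le> d * (H + 2)" using d H by (intro mult_left_mono) auto
    then show ?thesis using d3 eta by linarith
  qed
  define r where "r = 1 / (1 + d)"
  have r: "0 < r" "r < 1" using d by (auto simp: r_def)
  have upper_rate: "lam * (H + d) * (1 + d) \<le> c - eta/4"
  proof -
    have "lam * (H + d) * (1 + d) = lam * H + lam * (d * (1 + H + d))" by (simp add: algebra_simps)
    also have "lam * (d * (1 + H + d)) \<le> 1 * (d * (H + 2))"
      using lam d H by (intro mult_mono) auto
    finally show ?thesis using d3 lam eta by linarith
  qed
  have lower_rate: "c - eta \<le> lam * (H - 3 * d)"
  proof -
    have "lam * (3 * d) \<le> 1 * (3 * d)" using lam d by (intro mult_right_mono) auto
    then show ?thesis using d2 lam by (simp add: algebra_simps)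
  qed
  have "\<exists>J. r ^ J < d / (2 * (H + d))" using r d H by (intro real_arch_pow_inv) auto
  then obtain J where "r ^ J < d / (2 * (H + d))" ..
  then have "r ^ J * (2 * (H + d)) < d" using d H by (simp add: pos_less_divide_eq)
  then have J: "(H + d) * r ^ J \<le> d/2" by (simp add: algebra_simps)
  have J0: "J > 0" using J H d by (cases J) auto
  have "\<not> growth_le T (H - d) K" using low d by simp
  then obtain e1 d' where e1: "e1 > 0" "d' > 0"
    and big: "\<And>M. \<exists>m\<ge>M. \<exists>G\<subseteq>K. finite G \<and> bowen_separated T m e1 G \<and> exp ((H - d + d') * real m) < real (card G)"
    by (rule not_growth_leE) blast
  obtain M1 where M1: "\<And>m G. m \<ge> M1 \<Longrightarrow> G \<subseteq> K \<Longrightarrow> finite G \<Longrightarrow> bowen_separated T m e1 G \<Longrightarrow>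
      real (card G) \<le> exp ((H + d) * real m)"
    using up e1 d unfolding growth_le_def by metis
  have main: "\<exists>n\<ge>N. \<exists>E\<subseteq>K. finite E \<and> E \<noteq> {} \<and> bowen_separated T n e1 E \<and>
    exp ((c - eta) * real n) \<le> real (card E) \<and> (\<forall>x\<in>E. \<forall>y\<in>E. dist x y \<le> e) \<and>
    (\<forall>m. \<forall>G\<subseteq>E. bowen_separated T m e G \<longrightarrow> real (card G) \<le> exp (c * real m))"
    if e: "0 < e" for e N
  proof -
    \<comment> \<open>Points with a common ancestor are at most \<open>2 * J * e'\<close> apart.\<close>
    define e' where "e' = e / (2 * (real J + 1))"
    have e': "0 < e'" "2 * (real J * e') \<le> e" using e by (auto simp: e'_def field_simps)
    obtain M2 where M2: "\<And>m G. m \<ge> M2 \<Longrightarrow> G \<subseteq> K \<Longrightarrow> finite G \<Longrightarrow> bowen_separated T m e' G \<Longrightarrow>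
        real (card G) \<le> exp ((H + d) * real m)"
      using up e' d unfolding growth_le_def by metis
    have rJ: "0 < r ^ J" using r by simp
    have "\<forall>\<^sub>F n in sequentially. n \<ge> max (max N M1) 1 \<and> real M2 \<le> r ^ J * real n \<and> (H + d) \<le> d/2 * real n \<and>
        real J * ln 2 + lam * (H + d) \<le> eta/4 * r ^ J * real n \<and>
        (4 * (H + d) * real n + 6) ^ J \<le> exp (d * real n)"
      using rJ d eta H
      by (intro eventually_conj eventually_ge_at_top eventually_const_le_linear eventually_linear_power_le_exp) auto
    then obtain N' where N': "\<And>n. n \<ge> N' \<Longrightarrow> n \<ge> max (max N M1) 1 \<and> real M2 \<le> r ^ J * real n \<and> (H + d) \<le> d/2 * real n \<and>
        real J * ln 2 + lam * (H + d) \<le> eta/4 * r ^ J * real n \<and>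
        (4 * (H + d) * real n + 6) ^ J \<le> exp (d * real n)"
      unfolding eventually_sequentially by blast
    obtain n F where n: "n \<ge> N'" and F: "F \<subseteq> K" "finite F" "bowen_separated T n e1 F"
      and Fbig: "exp ((H - d + d') * real n) < real (card F)" using big[of N'] by blast
    have nN: "n \<ge> N" "n \<ge> M1" "n \<ge> 1" "real M2 \<le> r ^ J * real n" "(H + d) \<le> d/2 * real n"
      "real J * ln 2 + lam * (H + d) \<le> eta/4 * r ^ J * real n"
      "(4 * (H + d) * real n + 6) ^ J \<le> exp (d * real n)"
      using N'[OF n] by auto
    define t where "t = (\<lambda>j. nat \<lceil>r ^ j * real n\<rceil>)"
    have tub: "real (t j) \<le> r ^ j * real n + 1" and tlb: "r ^ j * real n \<le> real (t j)" for j
      using r(1) unfolding t_def by (simp_all add: of_nat_ceiling)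
    have t0: "t 0 = n" by (simp add: t_def)
    have anti: "antimono t"
    proof (rule antimonoI)
      fix i j :: nat assume "i \<le> j"
      then have "r ^ j * real n \<le> r ^ i * real n" using r by (intro mult_right_mono power_decreasing) auto
      then show "t j \<le> t i" unfolding t_def by (intro nat_mono ceiling_mono)
    qed
    have tM2: "M2 \<le> t j" if "j \<le> J" for j
    proof -
      have "real M2 \<le> real (t J)" using nN(4) tlb[of J] by linarith
      then show ?thesis using antimonoD[OF anti that] by simp
    qed
    have tJ1: "1 \<le> t J" using tlb[of J] rJ nN(3) by (smt (verit) mult_pos_pos of_nat_0_less_iff of_nat_1 of_nat_mono less_one not_less of_nat_0)
    obtain q where q: "leaf_tree q" and q0: "\<And>x. q 0 x = x"
      and qclose: "\<And>j x. j \<le> J \<Longrightarrow> x \<in> K \<Longrightarrow> bowen_close T (t j) (real j * e') x (q j x)"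
      and qcard: "\<And>j. 0 < j \<Longrightarrow> j \<le> J \<Longrightarrow> finite (q j ` K) \<and> real (card (q j ` K)) \<le> exp ((H + d) * real (t j))"
      using projection_tree[of e' t J K T "\<lambda>j. exp ((H + d) * real (t j))"] e'(1) anti M2[OF tM2] by auto
    have close: "bowen_close T (t j) e x y" if "j \<le> J" "x \<in> K" "y \<in> K" "q j x = q j y" for j x y
    proof -
      have "bowen_close T (t j) (real j * e' + real j * e') x y"
        using qclose[OF that(1,2)] qclose[OF that(1,3)] that(4)
        by (metis bowen_close_sym bowen_close_trans)
      moreover have "real j * e' \<le> real J * e'" using that(1) e'(1) by (intro mult_right_mono) auto
      then have "real j * e' + real j * e' \<le> e" using e'(2) by linarith
      ultimately show ?thesis by (blast intro: bowen_close_mono)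
    qed
    have Fcard: "real (card F) \<le> exp ((H + d) * real n)" using M1[OF nN(2) F] .
    have "F \<noteq> {}" using Fbig by (metis card.empty exp_ge_zero not_less of_nat_0)
    then have qJne: "q J ` K \<noteq> {}" using F(1) by blast
    \<comment> \<open>Keep only the points below one node at the top of the tree, with at least the average number of them.\<close>
    obtain v where v: "card F \<le> card {x\<in>F. q J x = v} * card (q J ` K)"
      using pigeonhole_popular[OF F(2), of "q J" "q J ` K"] qcard[OF J0] F(1) qJne by blast
    define F0 where "F0 = {x\<in>F. q J x = v}"
    have F0: "F0 \<subseteq> F" "F0 \<subseteq> K" "finite F0" using F by (auto simp: F0_def)
    have "card F > 0" using \<open>F \<noteq> {}\<close> F(2) by (simp add: card_gt_0_iff)
    then have "F0 \<noteq> {}" using v by (auto simp: F0_def[symmetric])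
    have tJ: "(H + d) * real (t J) \<le> d * real n"
    proof -
      have "(H + d) * real (t J) \<le> (H + d) * (r ^ J * real n + 1)" using tub H d by (intro mult_left_mono) auto
      also have "\<dots> = ((H + d) * r ^ J) * real n + (H + d)" by (simp add: algebra_simps)
      also have "\<dots> \<le> d/2 * real n + d/2 * real n" using J nN(5) by (intro add_mono mult_right_mono) auto
      finally show ?thesis by simp
    qed
    have F0card: "exp ((H - 2 * d) * real n) \<le> real (card F0)"
    proof -
      have "exp ((H - d) * real n) \<le> exp ((H - d + d') * real n)" using e1(2) by (simp add: mult_right_mono)
      also have "\<dots> \<le> real (card F)" using Fbig by simp
      also have "\<dots> \<le> real (card F0) * real (card (q J ` K))" using v by (metis F0_def of_nat_le_iff of_nat_mult)
      also have "\<dots> \<le> real (card F0) * exp (d * real n)"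
        using qcard[OF J0] tJ by (intro mult_left_mono) (auto intro: order_trans)
      finally have "exp ((H - d) * real n) / exp (d * real n) \<le> real (card F0)" by (simp add: divide_le_eq)
      then show ?thesis by (simp add: exp_diff[symmetric] algebra_simps)
    qed
    \<comment> \<open>\<open>L\<close> is an upper bound for the binary logarithm of the number of leaves that is linear in \<open>n\<close>;
      it uses \<open>exp 1 \<le> 4\<close>.\<close>
    define k where "k = nat \<lceil>(H + d) * real n\<rceil>"
    have k: "(H + d) * real n \<le> real k" "real k \<le> (H + d) * real n + 1"
      using H d unfolding k_def by (simp_all add: of_nat_ceiling) 
    define L where "L = 2 * k + 1"
    have cardL: "card F0 < 2 ^ L"
    proof -
      have "real (card F0) \<le> real (card F)" using F0 F(2) by (simp add: card_mono)
      also have "\<dots> \<le> exp (real k)" using Fcard k(1) by (meson exp_le_cancel_iff order_trans)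
      also have "\<dots> = exp 1 ^ k" by (simp add: exp_of_nat_mult[symmetric])
      also have "\<dots> \<le> 4 ^ k" using exp_le by (intro power_mono) auto
      also have "\<dots> < 2 * 4 ^ k" by simp
      also have "\<dots> = 2 ^ L" by (simp add: L_def power_mult)
      finally show ?thesis by (metis of_nat_less_iff of_nat_numeral of_nat_power)
    qed
    have inj: "inj_on (q 0) F0" by (simp add: q0 inj_on_def)
    have root: "\<forall>x\<in>F0. \<forall>y\<in>F0. q J x = q J y" by (simp add: F0_def)
    obtain E where "E \<subseteq> F0" and Ethin: "E \<noteq> {} \<and>
        (\<forall>j\<le>J. real (card (q j ` E)) \<le> 2 ^ J * real (card (q j ` F0)) powr lam) \<and>
        (real (card F0) / real ((2 * L) ^ J)) powr lam \<le> real (card E)"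
      using leaf_tree.thin_tree[OF q F0(3) \<open>F0 \<noteq> {}\<close> cardL inj root less_imp_le[OF lam(1)] less_imp_le[OF lam(2)]]
      by (elim exE conjE) (rule that, auto)
    then have E: "E \<subseteq> F0" "E \<noteq> {}"
      "\<And>j. j \<le> J \<Longrightarrow> real (card (q j ` E)) \<le> 2 ^ J * real (card (q j ` F0)) powr lam"
      "(real (card F0) / real ((2 * L) ^ J)) powr lam \<le> real (card E)" by auto
    have EK: "E \<subseteq> K" "finite E" using subset_trans[OF E(1) F0(2)] finite_subset[OF E(1) F0(3)] by auto
    have E_large: "exp ((c - eta) * real n) \<le> real (card E)"
    proof -
      have "real ((2 * L) ^ J) = (2 * real L) ^ J" by simp
      also have "\<dots> \<le> (4 * (H + d) * real n + 6) ^ J" using k(2) by (intro power_mono) (auto simp: L_def algebra_simps)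
      also have "\<dots> \<le> exp (d * real n)" by (rule nN(7))
      finally have L: "real ((2 * L) ^ J) \<le> exp (d * real n)" .
      have "exp ((c - eta) * real n) \<le> exp ((lam * (H - 3 * d)) * real n)"
        using lower_rate by (simp add: mult_right_mono)
      also have "\<dots> = (exp ((H - 2 * d) * real n) / exp (d * real n)) powr lam"
        by (simp add: exp_diff[symmetric] powr_def algebra_simps)
      also have "\<dots> \<le> (real (card F0) / real ((2 * L) ^ J)) powr lam"
        using F0card L lam by (intro powr_mono2 frac_le) (auto simp: L_def)
      also have "\<dots> \<le> real (card E)" using E(4) by simp
      finally show ?thesis .
    qed
    have E_separated: "bowen_separated T n e1 E" using bowen_separated_subset[OF F(3)] E(1) F0(1) by blast
    have E_small: "dist x y \<le> e" if "x \<in> E" "y \<in> E" for x y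
    proof -
      have "q J x = q J y" using that E(1) by (auto simp: F0_def)
      then have "bowen_close T (t J) e x y" using close[of J x y] that EK by auto
      then show ?thesis using tJ1 by (force simp: bowen_close_def)
    qed
    have E_growth: "real (card G) \<le> exp (c * real m)" if G: "G \<subseteq> E" "bowen_separated T m e G" for m G
    \<comment> \<open>Up to time \<open>t J\<close> the set lies in one Bowen ball; later times are compared with a level of the tree.\<close>
    proof (cases "m \<le> t J")
      case True
      have "card G \<le> card {v}"
      proof (rule bowen_separated_card_le[OF G(2), where f="\<lambda>_. v"])
        fix x y assume xy: "x \<in> G" "y \<in> G"
        then have "q J x = q J y" using E(1) G(1) by (auto simp: F0_def)
        then have "bowen_close T (t J) e x y" using close[of J x y] xy G(1) EK by auto
        then show "bowen_close T m e x y" using True by (rule bowen_close_mono) simp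
      qed auto
      then have "real (card G) \<le> 1" by simp
      also have "1 \<le> exp (c * real m)" using eta by simp
      finally show ?thesis .
    next
      case False
      then have tJm: "t J < m" by simp
      obtain j where j: "j \<le> J" "real (t j) \<le> real m / r + 1" "j = 0 \<or> m \<le> t j"
        using geometric_time_scale[OF r t_def tJm] by blast
      have "card G \<le> card (q j ` E)"
      proof (rule bowen_separated_card_le[OF G(2), where f="q j"])
        fix x y assume xy: "x \<in> G" "y \<in> G" "q j x = q j y"
        show "bowen_close T m e x y"
        proof (cases "j = 0")
          case True
          then show ?thesis using xy(3) e by (simp add: q0 bowen_close_refl)
        next
          case False
          then have "m \<le> t j" using j(3) by simp
          moreover have "bowen_close T (t j) e x y" using close[OF j(1)] xy G(1) EK by blast
          ultimately show ?thesis by (blast intro: bowen_close_mono)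
        qed
      qed (use EK G(1) in auto)
      then have "real (card G) \<le> real (card (q j ` E))" by simp
      also have "\<dots> \<le> 2 ^ J * real (card (q j ` F0)) powr lam" using E(3) j(1) by blast
      also have "\<dots> \<le> 2 ^ J * exp ((H + d) * real (t j)) powr lam"
      proof (intro mult_left_mono powr_mono2)
        show "real (card (q j ` F0)) \<le> exp ((H + d) * real (t j))"
        proof (cases "j = 0")
          case True
          have "real (card F0) \<le> real (card F)" using F0 F(2) by (simp add: card_mono)
          then show ?thesis using Fcard True by (simp add: q0 t0)
        next
          case False
          then have "finite (q j ` K)" "real (card (q j ` K)) \<le> exp ((H + d) * real (t j))" using qcard j(1) by auto
          then show ?thesis by (meson F0(2) card_mono image_mono of_nat_le_iff order_trans)
        qed
      qed (use lam in auto)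
      also have "\<dots> = exp (real J * ln 2 + lam * (H + d) * real (t j))"
      proof -
        have "exp ((H + d) * real (t j)) powr lam = exp (lam * (H + d) * real (t j))"
          by (simp add: exp_powr_real mult_ac)
        moreover have "(2::real) ^ J = exp (real J * ln 2)" by (simp add: exp_of_nat_mult)
        ultimately show ?thesis by (simp only: exp_add)
      qed
      also have "\<dots> \<le> exp (c * real m)"
      proof (subst exp_le_cancel_iff)
        have "lam * (H + d) * real (t j) \<le> lam * (H + d) * (real m / r + 1)"
          using j(2) lam H d by (intro mult_left_mono) auto
        also have "\<dots> = lam * (H + d) * (1 + d) * real m + lam * (H + d)" by (simp add: r_def algebra_simps)
        also have "\<dots> \<le> (c - eta/4) * real m + lam * (H + d)"
          using upper_rate by (intro add_right_mono mult_right_mono) auto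
        finally have 1: "real J * ln 2 + lam * (H + d) * real (t j) \<le>
            (c - eta/4) * real m + (real J * ln 2 + lam * (H + d))" by simp
        have "eta/4 * (r ^ J * real n) \<le> eta/4 * real m"
          using tlb[of J] tJm eta by (intro mult_left_mono) auto
        then have "real J * ln 2 + lam * (H + d) \<le> eta/4 * real m" using nN(6) by simp
        then show "real J * ln 2 + lam * (H + d) * real (t j) \<le> c * real m" using 1 by (simp add: algebra_simps)
      qed
      finally show ?thesis .
    qed
    show ?thesis
      by (intro exI[of _ n] exI[of _ E] conjI ballI allI impI)
        (use nN(1) EK E(2) E_large E_separated E_small E_growth in \<open>simp_all\<close>)
  qed
  then show ?thesis using e1(1) by blast
qed

section \<open>Gluing shrinking sets\<close>

lemma compact_insert_Union_shrinking:
  fixes x :: "'a::metric_space"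
  assumes "compact K" "x \<in> K" "\<And>i. compact (L i)" "\<And>i. L i \<subseteq> K"
    "\<And>i y. y \<in> L i \<Longrightarrow> dist y x \<le> 1 / real (Suc i)"
  shows "compact (insert x (\<Union>i. L i))"
proof -
  have eq: "insert x (\<Union>i. L i) = (\<Inter>n. (cball x (1 / real (Suc n)) \<inter> K) \<union> (\<Union>i<n. L i))" (is "?A = ?B")
  proof (intro set_eqI iffI)
    fix y assume y: "y \<in> ?A"
    show "y \<in> ?B"
    proof (rule INT_I)
      fix n
      show "y \<in> (cball x (1 / real (Suc n)) \<inter> K) \<union> (\<Union>i<n. L i)"
      proof (cases "y = x")
        case False
        then obtain i where i: "y \<in> L i" using y by blast
        have "y \<in> cball x (1 / real (Suc n)) \<inter> K" if "n \<le> i"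
        proof -
          have "1 / real (Suc i) \<le> 1 / real (Suc n)" using that by (intro divide_left_mono) auto
          then have "dist y x \<le> 1 / real (Suc n)" using assms(5)[OF i] by linarith
          then show ?thesis using i assms(4) by (auto simp: dist_commute)
        qed
        then show ?thesis using i by (cases "n \<le> i") auto
      qed (use assms(2) in auto)
    qed
  next
    fix y assume y: "y \<in> ?B"
    show "y \<in> ?A"
    proof (cases "y = x")
      case False
      then obtain n where "inverse (real (Suc n)) < dist x y"
        using reals_Archimedean[of "dist x y"] by auto
      then have "y \<notin> cball x (1 / real (Suc n))" by (simp add: inverse_eq_divide)
      then show ?thesis using y by auto
    qed simp
  qed
  have "closed ?B" using assms
    by (intro closed_INT ballI closed_Un closed_Int closed_UN closed_cball) (auto intro: compact_imp_closed)
  moreover have "?A \<subseteq> K" using assms(2,4) by auto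
  ultimately show ?thesis using assms(1) eq
    by (metis compact_Int_closed inf.absorb_iff2)
qed

text \<open>Sets that shrink to a point \<open>x\<close> can be glued without a gain of entropy. Along a sufficiently sparse subsequence,
  the \<open>i\<close>-th set stays close to the orbit of \<open>x\<close> up to time \<open>i\<close>. So at time \<open>m\<close> all
  but about \<open>m\<close> of the sets are indistinguishable from \<open>x\<close>, and each of the remaining ones contributes at most
  about \<open>exp (a * m)\<close> separated points; the factor \<open>m\<close> is harmless.

  The hypothesis \<open>unif\<close> makes the bound uniform in \<open>i\<close>: at a fixed scale it holds from one time on for all
  sets with large index, while \<open>growth_le T a (L i)\<close> takes care of the finitely many others.\<close>

lemma glue_growth:
  assumes X: "compact X" "continuous_on X T" "T ` X \<subseteq> X" and K: "compact K" "K \<subseteq> X" and "0 \<le> a"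
    and L: "\<And>i. compact (L i)" "\<And>i. L i \<subseteq> K" "\<And>i. L i \<noteq> {}" "\<And>i. growth_le T a (L i)"
    and small: "\<And>i. \<forall>x\<in>L i. \<forall>y\<in>L i. dist x y \<le> 1 / real (Suc i)"
    and unif: "\<And>i. \<forall>m. \<forall>G\<subseteq>L i. finite G \<longrightarrow> bowen_separated T m (1 / real (Suc i)) G \<longrightarrow>
        real (card G) \<le> exp ((a + 1 / real (Suc i)) * real m)"
  obtains x and s :: "nat \<Rightarrow> nat" where "strict_mono s" "x \<in> K" "compact (insert x (\<Union>i. L (s i)))"
    "growth_le T a (insert x (\<Union>i. L (s i)))"
proof -
  have "\<forall>i. \<exists>z. z \<in> L i" using L(3) by blast
  then obtain z where z: "\<And>i. z i \<in> L i" by metis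
  then have "\<forall>i. z i \<in> K" using L(2) by blast
  then obtain x r where x: "x \<in> K" "strict_mono r" "(\<lambda>k. z (r k)) \<longlonglongrightarrow> x"
    unfolding comp_def[symmetric] using seq_compactE[OF compact_imp_seq_compact[OF K(1)]] by blast
  \<comment> \<open>The factor \<open>2\<close> makes any two points near \<open>x\<close> close at scale \<open>1 / (i + 1)\<close>.\<close>
  define near where "near i k \<longleftrightarrow> (\<forall>y\<in>L (r k). bowen_close T (Suc i) (1 / (2 * real (Suc i))) y x)" for i k
  have near: "\<forall>\<^sub>F k in sequentially. near i k" for i
  proof -
    obtain d where d: "d > 0" "\<forall>y\<in>X. \<forall>y'\<in>X. dist y y' < d \<longrightarrow> bowen_close T (Suc i) (1 / (2 * real (Suc i))) y y'"
      using bowen_close_uniform[OF X, of "1 / (2 * real (Suc i))" "Suc i"] by auto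
    have "\<forall>\<^sub>F k in sequentially. dist (z (r k)) x < d/2" using x(3) d(1) by (intro tendstoD) auto
    moreover have "\<forall>\<^sub>F k in sequentially. 1 / real (Suc k) < d/2"
      using d(1) by (intro order_tendstoD(2)[OF lim_1_over_n[THEN LIMSEQ_Suc]]) auto
    ultimately show ?thesis
    proof eventually_elim
      case (elim k)
      show ?case unfolding near_def
      proof
        fix y assume y: "y \<in> L (r k)"
        have "1 / real (Suc (r k)) \<le> 1 / real (Suc k)"
          using strict_mono_imp_increasing[OF x(2), of k] by (intro divide_left_mono) auto
        then have "dist y (z (r k)) < d/2" using small[rule_format, OF y z] elim by linarith
        then have "dist y x < d" using elim(1) by (metis dist_commute dist_triangle_half_r)
        then show "bowen_close T (Suc i) (1 / (2 * real (Suc i))) y x" using d(2) y L(2) K(2) x(1) by blast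
      qed
    qed
  qed
  have "\<exists>k. \<forall>i. near i (k i) \<and> k i < k (Suc i)"
  proof (rule dependent_nat_choice)
    show "\<exists>k. near 0 k" using near[of 0] eventually_happens sequentially_bot by blast
    show "\<exists>k'. near (Suc i) k' \<and> k < k'" if "near i k" for k i
      using eventually_conj[OF near[of "Suc i"] eventually_gt_at_top[of k]]
      by (rule eventually_happens'[OF sequentially_bot])
  qed
  then obtain k where k: "\<And>i. near i (k i)" "strict_mono k" by (auto simp: strict_mono_Suc_iff)
  define s where "s = r \<circ> k"
  have s: "strict_mono s" unfolding s_def using x(2) k(2) by (rule strict_mono_o)
  have si: "i \<le> s i" for i using strict_mono_imp_increasing[OF s] .
  have ns: "bowen_close T (Suc i) (1 / (2 * real (Suc i))) y x" if "y \<in> L (s i)" for i y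
    using k(1)[of i] that by (simp add: near_def s_def)
  let ?K = "insert x (\<Union>i. L (s i))"
  have "compact ?K"
  proof (rule compact_insert_Union_shrinking[OF K(1) x(1)])
    fix i y assume "y \<in> L (s i)"
    then have "dist y x \<le> 1 / (2 * real (Suc i))" using ns[of y i] by (force simp: bowen_close_def)
    also have "\<dots> \<le> 1 / real (Suc i)" by (simp add: field_simps)
    finally show "dist y x \<le> 1 / real (Suc i)" .
  qed (use L in auto)
  moreover have "growth_le T a ?K"
    unfolding growth_le_def
  proof (intro allI impI)
    fix e d :: real assume e: "0 < e" and d: "0 < d"
    obtain I where I: "inverse (real (Suc I)) < min e (d/2)"
      using reals_Archimedean[of "min e (d/2)"] e d by auto
    have Ii: "1 / real (Suc i) \<le> e" "1 / real (Suc i) \<le> d/2" if "I \<le> i" for i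
    proof -
      have "1 / real (Suc i) \<le> 1 / real (Suc I)" using that by (intro divide_left_mono) auto
      then show "1 / real (Suc i) \<le> e" "1 / real (Suc i) \<le> d/2" using I by (auto simp: inverse_eq_divide)
    qed
    have "growth_le T a (\<Union>(L ` {..<I}))" using L(4) by (intro growth_le_finite_Union) auto
    then obtain M where M: "\<And>m G. m \<ge> M \<Longrightarrow> G \<subseteq> \<Union>(L ` {..<I}) \<Longrightarrow> finite G \<Longrightarrow> bowen_separated T m e G \<Longrightarrow>
        real (card G) \<le> exp ((a + d/2) * real m)"
      using e d unfolding growth_le_def by (metis half_gt_zero)
    have one: "real (card G) \<le> exp ((a + d/2) * real m)"
      if "m \<ge> M" "G \<subseteq> L i" "finite G" "bowen_separated T m e G" for m G i
    proof (cases "i < I")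
      case True
      then show ?thesis using M that by blast
    next
      case False
      then have i: "I \<le> i" by simp
      have "real (card G) \<le> exp ((a + 1 / real (Suc i)) * real m)"
        using that(2-4) Ii(1)[OF i] by (intro unif[rule_format]) (auto elim: bowen_separated_mono)
      also have "\<dots> \<le> exp ((a + d/2) * real m)" using Ii(2)[OF i] by (simp add: mult_right_mono)
      finally show ?thesis .
    qed
    obtain M' where M': "\<And>m. m \<ge> M' \<Longrightarrow> 1 * real m + real (I + 1) \<le> exp (d/2 * real m)"
      using eventually_linear_power_le_exp[of "d/2" 1 "real (I+1)" 1] d by (auto simp: eventually_sequentially)
    have "real (card G) \<le> exp ((a + d) * real m)"
      if m: "m \<ge> max M M'" and G: "G \<subseteq> ?K" "finite G" "bowen_separated T m e G" for m G
    proof -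
      \<comment> \<open>From index \<open>m + I\<close> on, both the length \<open>m\<close> and the scale \<open>e / 2\<close> are covered by
        the closeness to \<open>x\<close>.\<close>
      define Gx where "Gx = {g\<in>G. bowen_close T m (e/2) g x}"
      have "G \<subseteq> Gx \<union> (\<Union>i<m + I. G \<inter> L (s i))"
      proof
        fix g assume g: "g \<in> G"
        have "bowen_close T m (e/2) g x" if i: "g \<in> L (s i)" "m + I \<le> i" for i
        proof (rule bowen_close_mono[OF ns[OF i(1)]])
          show "1 / (2 * real (Suc i)) \<le> e/2" using Ii(1)[of i] i(2) by (simp add: field_simps)
        qed (use i in auto)
        moreover have "bowen_close T m (e/2) x x" using e by (intro bowen_close_refl) simp
        ultimately have "g \<in> Gx \<or> (\<exists>i<m + I. g \<in> L (s i))"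
          using g G(1) unfolding Gx_def by (cases "g = x") (auto simp: not_less[symmetric])
        then show "g \<in> Gx \<union> (\<Union>i<m + I. G \<inter> L (s i))" using g by blast
      qed
      then have "card G \<le> card (Gx \<union> (\<Union>i<m + I. G \<inter> L (s i)))" using G(2) by (intro card_mono) (auto simp: Gx_def)
      also have "\<dots> \<le> card Gx + card (\<Union>i<m + I. G \<inter> L (s i))" by (rule card_Un_le)
      also have "\<dots> \<le> card Gx + (\<Sum>i<m + I. card (G \<inter> L (s i)))"
        by (intro add_left_mono card_UN_le) simp
      also have "card Gx \<le> card {x}"
      proof (rule bowen_separated_card_le[where f="\<lambda>_. x"])
        fix y y' assume "y \<in> Gx" "y' \<in> Gx"
        then have "bowen_close T m (e/2 + e/2) y y'" unfolding Gx_def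
          by (blast intro: bowen_close_trans bowen_close_sym)
        then show "bowen_close T m e y y'" by simp
      qed (use bowen_separated_subset[OF G(3)] in \<open>auto simp: Gx_def\<close>)
      finally have "card G \<le> 1 + (\<Sum>i<m + I. card (G \<inter> L (s i)))" by simp
      then have "real (card G) \<le> 1 + (\<Sum>i<m + I. real (card (G \<inter> L (s i))))" by (metis of_nat_1 of_nat_add of_nat_le_iff of_nat_sum)
      also have "\<dots> \<le> 1 + (\<Sum>i<m + I. exp ((a + d/2) * real m))"
        using m G bowen_separated_subset[OF G(3)] by (intro add_left_mono sum_mono one) auto
      also have "\<dots> = 1 + real (m + I) * exp ((a + d/2) * real m)" by simp
      also have "\<dots> \<le> (1 * real m + real (I + 1)) * exp ((a + d/2) * real m)"
        using \<open>0 \<le> a\<close> d by (simp add: algebra_simps)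
      also have "\<dots> \<le> exp (d/2 * real m) * exp ((a + d/2) * real m)"
        using M'[of m] m by (intro mult_right_mono) auto
      also have "\<dots> = exp ((a + d) * real m)" by (simp add: exp_add[symmetric] algebra_simps)
      finally show ?thesis .
    qed
    then show "\<exists>M. \<forall>m\<ge>M. \<forall>G\<subseteq>?K. finite G \<longrightarrow> bowen_separated T m e G \<longrightarrow> real (card G) \<le> exp ((a + d) * real m)"
      by blast
  qed
  ultimately show ?thesis by (rule that[OF s x(1)])
qed

section \<open>Lowering the entropy\<close>

text \<open>Glue thinned separated sets at scales \<open>1 / (i + 1)\<close> and times tending to infinity. They are all separated at one and the same scale
  \<open>e1\<close>, so the glued set keeps an entropy of almost \<open>c\<close> there.\<close>

lemma approximate_lowering:
  assumes X: "compact X" "continuous_on X T" "T ` X \<subseteq> X" and K: "compact K" "K \<subseteq> X"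
    and up: "growth_le T H K" and low: "\<And>b. b < H \<Longrightarrow> \<not> growth_le T b K"
    and eta: "0 < eta" "eta < c" and c: "c < H"
  shows "\<exists>K'\<subseteq>K. compact K' \<and> growth_le T c K' \<and> \<not> growth_le T (c - eta) K'"
proof -
  obtain e1 where e1: "e1 > 0" and sets: "\<forall>e>0. \<forall>N. \<exists>n\<ge>N. \<exists>E\<subseteq>K. finite E \<and> E \<noteq> {} \<and> bowen_separated T n e1 E \<and>
    exp ((c - eta/2) * real n) \<le> real (card E) \<and> (\<forall>x\<in>E. \<forall>y\<in>E. dist x y \<le> e) \<and>
    (\<forall>m. \<forall>G\<subseteq>E. bowen_separated T m e G \<longrightarrow> real (card G) \<le> exp (c * real m))"
    using thinned_separated_sets[OF up low _ _ c, of "eta/2"] eta by auto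
  define good where "good i n E \<longleftrightarrow> n \<ge> i \<and> E \<subseteq> K \<and> finite E \<and> E \<noteq> {} \<and> bowen_separated T n e1 E \<and>
    exp ((c - eta/2) * real n) \<le> real (card E) \<and> (\<forall>x\<in>E. \<forall>y\<in>E. dist x y \<le> 1 / real (Suc i)) \<and>
    (\<forall>m. \<forall>G\<subseteq>E. bowen_separated T m (1 / real (Suc i)) G \<longrightarrow> real (card G) \<le> exp (c * real m))" for i n E
  have "\<exists>n E. good i n E" for i
  proof -
    have "0 < 1 / real (Suc i)" by simp
    from sets[rule_format, OF this, of i] show ?thesis unfolding good_def by blast
  qed
  then obtain n E where good: "\<And>i. good i (n i) (E i)" by metis
  note nE = good[unfolded good_def]
  have c0: "0 \<le> c" using eta by simp
  have 1: "compact (E i)" "E i \<subseteq> K" "E i \<noteq> {}" "growth_le T c (E i)" for i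
    using nE c0 by (simp_all add: finite_imp_compact growth_le_finite)
  have 2: "\<forall>x\<in>E i. \<forall>y\<in>E i. dist x y \<le> 1 / real (Suc i)" for i using nE by blast
  have 3: "\<forall>m. \<forall>G\<subseteq>E i. finite G \<longrightarrow> bowen_separated T m (1 / real (Suc i)) G \<longrightarrow>
      real (card G) \<le> exp ((c + 1 / real (Suc i)) * real m)" for i
  proof (intro allI impI)
    fix m G assume "G \<subseteq> E i" "bowen_separated T m (1 / real (Suc i)) G"
    then have "real (card G) \<le> exp (c * real m)" using nE by blast
    also have "\<dots> \<le> exp ((c + 1 / real (Suc i)) * real m)" by (simp add: mult_right_mono)
    finally show "real (card G) \<le> exp ((c + 1 / real (Suc i)) * real m)" .
  qed
  obtain x s where s: "strict_mono (s :: nat \<Rightarrow> nat)" "x \<in> K" "compact (insert x (\<Union>i. E (s i)))"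
    "growth_le T c (insert x (\<Union>i. E (s i)))"
    using glue_growth[OF X K c0 1 2 3] by blast
  have "\<not> growth_le T (c - eta) (insert x (\<Union>i. E (s i)))"
  proof
    assume "growth_le T (c - eta) (insert x (\<Union>i. E (s i)))"
    moreover have "0 < eta/4" using eta by simp
    ultimately obtain M where M: "\<forall>m\<ge>M. \<forall>G\<subseteq>insert x (\<Union>i. E (s i)). finite G \<longrightarrow> bowen_separated T m e1 G \<longrightarrow>
        real (card G) \<le> exp ((c - eta + eta/4) * real m)"
      using e1 unfolding growth_le_def by blast
    define i where "i = s (Suc M)"
    have "Suc M \<le> i" unfolding i_def by (rule strict_mono_imp_increasing[OF s(1)])
    moreover have "i \<le> n i" using nE by blast
    ultimately have n: "M \<le> n i" "0 < n i" by auto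
    have "E i \<subseteq> insert x (\<Union>i. E (s i))" by (auto simp: i_def)
    then have "real (card (E i)) \<le> exp ((c - eta + eta/4) * real (n i))" using M n(1) nE by blast
    moreover have "exp ((c - eta/2) * real (n i)) \<le> real (card (E i))" using nE by blast
    ultimately have "exp ((c - eta/2) * real (n i)) \<le> exp ((c - eta + eta/4) * real (n i))" by linarith
    then have "c - eta/2 \<le> c - eta + eta/4" using n(2) by simp
    then show False using eta by simp
  qed
  moreover have "insert x (\<Union>i. E (s i)) \<subseteq> K" using s(2) nE by blast
  ultimately show ?thesis using s by blast
qed

text \<open>The entropy of a finite union is the maximum of the entropies, so the growth of a compact set is already found in
  an arbitrarily small piece of it.\<close>

lemma small_piece:
  assumes X: "compact X" "continuous_on X T" "T ` X \<subseteq> X" and A: "compact A" "A \<subseteq> X"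
    and b: "\<not> growth_le T b A" and "0 < e"
  shows "\<exists>P\<subseteq>A. compact P \<and> \<not> growth_le T b P \<and> (\<forall>x\<in>P. \<forall>y\<in>P. bowen_close T n e x y)"
proof -
  obtain d where d: "d > 0" "\<forall>x\<in>X. \<forall>y\<in>X. dist x y < d \<longrightarrow> bowen_close T n e x y"
    using bowen_close_uniform[OF X \<open>0 < e\<close>] by blast
  obtain C where C: "C \<subseteq> A" "finite C" "A \<subseteq> (\<Union>c\<in>C. ball c (d/3))"
    using compactE_image[OF A(1), of A "\<lambda>c. ball c (d/3)"] d(1) by force
  define P where "P c = A \<inter> cball c (d/3)" for c
  have "A = \<Union>(P ` C)" using C(3) by (force simp: P_def)
  then obtain c where c: "\<not> growth_le T b (P c)"
    using growth_le_finite_Union[of "P ` C" T b] C(2) b by auto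
  have "bowen_close T n e x y" if xy: "x \<in> P c" "y \<in> P c" for x y
  proof -
    have "dist c x \<le> d/3" "dist c y \<le> d/3" using xy by (auto simp: P_def)
    then have "dist x y < d" using dist_triangle2[of x y c] d(1) by (simp add: dist_commute)
    then show ?thesis using d(2) xy A(2) by (auto simp: P_def)
  qed
  moreover have "compact (P c)" unfolding P_def using A(1) by (intro compact_Int_closed) auto
  moreover have "P c \<subseteq> A" by (auto simp: P_def)
  ultimately show ?thesis using c by blast
qed

text \<open>One gluing reaches \<open>h\<close> only up to an error, since the scale \<open>e1\<close> depends on the error. A second
  gluing, of sets with entropies tending to \<open>h\<close> from below, removes it. Each of them is first replaced by a piece so small that it looks like a
  point until the time from which its own growth bound at scale \<open>1 / (i + 1)\<close> is valid; this provides the uniformity that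
  gluing requires.\<close>

lemma exact_lowering:
  assumes X: "compact X" "continuous_on X T" "T ` X \<subseteq> X" and K: "compact K" "K \<subseteq> X"
    and up: "growth_le T H K" and low: "\<And>b. b < H \<Longrightarrow> \<not> growth_le T b K"
    and h: "0 < h" "h < H"
  shows "\<exists>K'\<subseteq>K. K' \<noteq> {} \<and> compact K' \<and> growth_le T h K' \<and> (\<forall>b<h. \<not> growth_le T b K')"
proof -
  have "\<exists>P. compact P \<and> P \<subseteq> K \<and> growth_le T h P \<and> \<not> growth_le T (h - 1 / real (Suc i)) P \<and>
      (\<forall>x\<in>P. \<forall>y\<in>P. dist x y \<le> 1 / real (Suc i)) \<and>
      (\<forall>m G. G \<subseteq> P \<longrightarrow> finite G \<longrightarrow> bowen_separated T m (1 / real (Suc i)) G \<longrightarrow>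
        real (card G) \<le> exp ((h + 1 / real (Suc i)) * real m))" for i
  proof -
    define e where "e = 1 / real (Suc i)"
    have e: "0 < e" by (simp add: e_def)
    define eta where "eta = min e (h/2)"
    have eta: "0 < eta" "eta < h" using e h by (auto simp: eta_def)
    obtain A where A: "A \<subseteq> K" "compact A" "growth_le T h A" "\<not> growth_le T (h - eta) A"
      using approximate_lowering[OF X K up low eta h(2)] by blast
    have nA: "\<not> growth_le T (h - e) A"
      using A(4) growth_le_mono[of T "h - e" A "h - eta"] by (auto simp: eta_def)
    obtain M where M: "\<forall>m\<ge>M. \<forall>G\<subseteq>A. finite G \<longrightarrow> bowen_separated T m e G \<longrightarrow> real (card G) \<le> exp ((h + e) * real m)"
      using A(3) e unfolding growth_le_def by blast
    obtain P where P: "P \<subseteq> A" "compact P" "\<not> growth_le T (h - e) P"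
      "\<forall>x\<in>P. \<forall>y\<in>P. bowen_close T (Suc M) e x y"
      using small_piece[OF X A(2) _ nA e, of "Suc M"] A(1) K(2) by blast
    have "real (card G) \<le> exp ((h + e) * real m)"
      if G: "G \<subseteq> P" "finite G" "bowen_separated T m e G" for m G
    proof (cases "M \<le> m")
      case True
      then show ?thesis using M G P(1) by blast
    next
      case False
      have "card G \<le> card {()}"
      proof (rule bowen_separated_card_le[OF G(3), where f="\<lambda>_. ()"])
        fix x y assume "x \<in> G" "y \<in> G"
        then have "bowen_close T (Suc M) e x y" using P(4) G(1) by blast
        then show "bowen_close T m e x y" using False by (auto elim: bowen_close_mono)
      qed auto
      then have "real (card G) \<le> 1" by simp
      also have "1 \<le> exp ((h + e) * real m)" using h e by simp
      finally show ?thesis .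
    qed
    moreover have "dist x y \<le> e" if "x \<in> P" "y \<in> P" for x y
      using P(4) that by (force simp: bowen_close_def)
    ultimately show ?thesis unfolding e_def[symmetric]
      using P A(1) growth_le_subset[OF A(3) P(1)] by (intro exI[of _ P]) auto
  qed
  then have "\<exists>P. \<forall>i. compact (P i) \<and> P i \<subseteq> K \<and> growth_le T h (P i) \<and> \<not> growth_le T (h - 1 / real (Suc i)) (P i) \<and>
      (\<forall>x\<in>P i. \<forall>y\<in>P i. dist x y \<le> 1 / real (Suc i)) \<and>
      (\<forall>m G. G \<subseteq> P i \<longrightarrow> finite G \<longrightarrow> bowen_separated T m (1 / real (Suc i)) G \<longrightarrow>
        real (card G) \<le> exp ((h + 1 / real (Suc i)) * real m))"
    by (intro choice allI)
  then obtain P where P: "\<forall>i. compact (P i) \<and> P i \<subseteq> K \<and> growth_le T h (P i) \<and> \<not> growth_le T (h - 1 / real (Suc i)) (P i) \<and>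
      (\<forall>x\<in>P i. \<forall>y\<in>P i. dist x y \<le> 1 / real (Suc i)) \<and>
      (\<forall>m G. G \<subseteq> P i \<longrightarrow> finite G \<longrightarrow> bowen_separated T m (1 / real (Suc i)) G \<longrightarrow>
        real (card G) \<le> exp ((h + 1 / real (Suc i)) * real m))" ..
  have notP: "\<not> growth_le T (h - 1 / real (Suc i)) (P i)" for i using P by blast
  have 1: "compact (P i)" "P i \<subseteq> K" "P i \<noteq> {}" "growth_le T h (P i)" for i
  proof -
    show "P i \<noteq> {}"
    proof
      assume "P i = {}"
      then have "growth_le T (h - 1 / real (Suc i)) (P i)" by (simp add: growth_le_def)
      then show False using notP by blast
    qed
  qed (use P in blast)+
  have 2: "\<forall>x\<in>P i. \<forall>y\<in>P i. dist x y \<le> 1 / real (Suc i)" for i using P by blast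
  have 3: "\<forall>m. \<forall>G\<subseteq>P i. finite G \<longrightarrow> bowen_separated T m (1 / real (Suc i)) G \<longrightarrow>
      real (card G) \<le> exp ((h + 1 / real (Suc i)) * real m)" for i
    using P by blast
  have h0: "0 \<le> h" using h by simp
  obtain x s where s: "strict_mono (s :: nat \<Rightarrow> nat)" "x \<in> K" "compact (insert x (\<Union>i. P (s i)))"
    "growth_le T h (insert x (\<Union>i. P (s i)))"
    using glue_growth[OF X K h0 1 2 3] by blast
  have "\<not> growth_le T b (insert x (\<Union>i. P (s i)))" if b: "b < h" for b
  proof
    assume g: "growth_le T b (insert x (\<Union>i. P (s i)))"
    obtain i where i: "inverse (real (Suc i)) < h - b" using reals_Archimedean[of "h - b"] b by auto
    have "i \<le> s i" by (rule strict_mono_imp_increasing[OF s(1)])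
    then have "1 / real (Suc (s i)) \<le> 1 / real (Suc i)" by (intro divide_left_mono) auto
    then have le: "b \<le> h - 1 / real (Suc (s i))" using i by (simp add: inverse_eq_divide)
    have "growth_le T b (P (s i))" by (rule growth_le_subset[OF g]) auto
    then have "growth_le T (h - 1 / real (Suc (s i))) (P (s i))" using le by (rule growth_le_mono)
    then show False using notP by blast
  qed
  moreover have "insert x (\<Union>i. P (s i)) \<subseteq> K" using s(2) 1(2) by blast
  ultimately show ?thesis using s by blast
qed

theorem theorem1p3:
  fixes X :: "'a::metric_space set" and T :: "'a \<Rightarrow> 'a"
  assumes "tds X T"
    and "entropy X T X < \<infinity>"
  shows "hereditarily_lowerable X T"
  unfolding hereditarily_lowerable_def
proof (intro allI impI)
  fix K and h :: real
  assume "K \<subseteq> X \<and> K \<noteq> {} \<and> compact K" and "0 \<le> h \<and> ereal h \<le> entropy X T K"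
  then have K: "K \<subseteq> X" "K \<noteq> {}" "compact K" and h: "0 \<le> h" "ereal h \<le> entropy X T K" by auto
  have X: "compact X" "continuous_on X T" "T ` X \<subseteq> X"
    using assms(1) unfolding tds_def homeomorphism_def by auto
  have "\<exists>a\<ge>0. entropy X T X \<le> ereal a"
  proof (cases "entropy X T X")
    case (real b)
    then show ?thesis by (intro exI[of _ "max 0 b"]) auto
  qed (use assms(2) in auto)
  then obtain a where a: "0 \<le> a" "entropy X T X \<le> ereal a" by blast
  then have "growth_le T a K"
    using growth_le_of_entropy_le[OF X(1,3) subset_refl] K(1) growth_le_subset by blast
  then have "entropy X T K \<le> ereal a" using entropy_le_of_growth_le X K a by blast
  then obtain H where H: "entropy X T K = ereal H"
    using h by (cases "entropy X T K") auto
  have HK: "growth_le T H K" using growth_le_of_entropy_le[OF X(1,3) K(1)] H by simp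
  have low: "\<not> growth_le T b K" if "b < H" for b
  proof
    assume b: "growth_le T b K"
    then have "entropy X T K \<le> ereal b"
      using entropy_le_of_growth_le[OF X(1,3) K(1) b] growth_le_nonneg[OF b K(2)] by blast
    then show False using H that by simp
  qed
  consider "h = H" | "h = 0" | "0 < h" "h < H" using h H by fastforce
  then show "\<exists>K\<^sub>h\<subseteq>K. K\<^sub>h \<noteq> {} \<and> compact K\<^sub>h \<and> entropy X T K\<^sub>h = ereal h"
  proof cases
    case 1
    then show ?thesis using K H by blast
  next
    case 2
    obtain x where x: "x \<in> K" using K(2) by blast
    have "entropy X T {x} = ereal 0"
    proof (rule entropy_eqI[OF X(1,3)])
      show "\<not> growth_le T b {x}" if "b < 0" for b using growth_le_nonneg[of T b "{x}"] that by auto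
    qed (use x K growth_le_finite[of "{x}" 0 T] in auto)
    then show ?thesis using 2 x by (intro exI[of _ "{x}"]) auto
  next
    case 3
    obtain K' where K': "K' \<subseteq> K" "K' \<noteq> {}" "compact K'" "growth_le T h K'" "\<forall>b<h. \<not> growth_le T b K'"
      using exact_lowering[OF X K(3,1) HK low 3] by blast
    have "K' \<subseteq> X" using K' K by blast
    then have "entropy X T K' = ereal h" using entropy_eqI[OF X(1,3) _ h(1) K'(4)] K'(5) by blast
    then show ?thesis using K' by blast
  qed
qed

end
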